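(* For any two points in $(SPD(n),g_W)$ there exists a unique geodesic joining them (up to parametrization); that is, there is no cut locus on any geodesic.
   Context: $SPD(n)$ is the set of real symmetric positive-definite $n\times n$ matrices, an open subset of the space $Sym(n)$ of real symmetric matrices, so $T_ASPD(n)\cong Sym(n)$. For $A\in SPD(n)$ and a real $n\times n$ matrix $X$, $\Gamma_A[X]$ denotes the unique real matrix satisfying $A\,\Gamma_A[X]+\Gamma_A[X]\,A=X$. The Wasserstein metric is the Riemannian metric $g_W|_A(X,Y)=\mathrm{tr}(\Gamma_A[Y]\,A\,\Gamma_A[X])=\frac12\mathrm{tr}(\Gamma_A[Y]X)$ for $X,Y\in T_ASPD(n)$. A cut point of a point $p$ along a geodesic starting at $p$ is a point of the geodesic beyond which the geodesic ceases to be length-minimizing from $p$; "no cut locus" means that no geodesic has a cut point. *)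

theory Defs
  imports "HOL-Analysis.Analysis"
begin

definition Sym :: "(real^'n^'n) set" where
  "Sym = {X. transpose X = X}"

definition SPD :: "(real^'n^'n) set" where
  "SPD = {A \<in> Sym. \<forall>x. x \<noteq> 0 \<longrightarrow> x \<bullet> (A *v x) > 0}"

text \<open>The solution of the Lyapunov (Sylvester) equation; it exists and is unique for
  \<open>A \<in> SPD\<close>.\<close>

definition lyap :: "real^'n^'n \<Rightarrow> real^'n^'n \<Rightarrow> real^'n^'n" where
  "lyap A X = (THE G. A ** G + G ** A = X)"

definition gW :: "real^'n^'n \<Rightarrow> real^'n^'n \<Rightarrow> real^'n^'n \<Rightarrow> real" where
  "gW A X Y = trace (lyap A Y ** A ** lyap A X)"

text \<open>\<open>SPD\<close> is open in the vector space \<open>Sym\<close>, which therefore serves as a global chart and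
  as the tangent space at every point. The derivative of the metric coefficients \<open>gW A X Y\<close>
  with respect to \<open>A\<close> in the direction \<open>Z\<close>, for fixed \<open>X\<close> and \<open>Y\<close>:\<close>

definition dgW :: "real^'n^'n \<Rightarrow> real^'n^'n \<Rightarrow> real^'n^'n \<Rightarrow> real^'n^'n \<Rightarrow> real" where
  "dgW A Z X Y = deriv (\<lambda>s. gW (A + s *\<^sub>R Z) X Y) 0"

text \<open>The Levi-Civita connection in this chart is \<open>\<nabla>\<^sub>X Y = DY[X] + christoffel A X Y\<close>;
  for constant (hence commuting) vector fields the Koszul formula reduces to the condition
  below, which determines \<open>christoffel A X Y\<close> because \<open>gW A\<close> is positive definite on \<open>Sym\<close>.\<close>

definition christoffel :: "real^'n^'n \<Rightarrow> real^'n^'n \<Rightarrow> real^'n^'n \<Rightarrow> real^'n^'n" where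
  "christoffel A X Y = (THE C. C \<in> Sym \<and>
     (\<forall>Z\<in>Sym. gW A C Z = (dgW A X Y Z + dgW A Y X Z - dgW A Z X Y) / 2))"

text \<open>Geodesics are parametrized curves with vanishing covariant acceleration. The interval
  may be open, closed or half-open; derivatives at its endpoints are one-sided.\<close>

definition geodesic_on :: "real set \<Rightarrow> (real \<Rightarrow> real^'n^'n) \<Rightarrow> bool" where
  "geodesic_on I \<gamma> \<longleftrightarrow> is_interval I \<and> \<gamma> ` I \<subseteq> SPD \<and>
     (\<exists>V W. \<forall>t\<in>I. (\<gamma> has_vector_derivative V t) (at t within I) \<and>
                  (V has_vector_derivative W t) (at t within I) \<and>
                  W t + christoffel (\<gamma> t) (V t) (V t) = 0)"

definition geodesic_joining ::
    "real \<Rightarrow> real \<Rightarrow> (real \<Rightarrow> real^'n^'n) \<Rightarrow> real^'n^'n \<Rightarrow> real^'n^'n \<Rightarrow> bool" where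
  "geodesic_joining a b \<gamma> A B \<longleftrightarrow> a < b \<and> geodesic_on {a..b} \<gamma> \<and> \<gamma> a = A \<and> \<gamma> b = B"

text \<open>Piecewise \<open>C\<^sup>1\<close> in the sense of Riemannian geometry: \<open>C\<^sup>1\<close> up to the endpoints on each
  closed piece of a finite subdivision. The predicate
  \<open>piecewise_C1_differentiable_on\<close> is weaker: it puts no condition on the velocity
  near the break points, where the speed may then fail to be integrable.\<close>

definition pw_C1_curve :: "real \<Rightarrow> real \<Rightarrow> (real \<Rightarrow> real^'n^'n) \<Rightarrow> bool" where
  "pw_C1_curve a b c \<longleftrightarrow> a \<le> b \<and> c ` {a..b} \<subseteq> SPD \<and>
     (\<exists>S. finite S \<and>
       (\<forall>u v. a \<le> u \<and> u < v \<and> v \<le> b \<and> {u<..<v} \<inter> S = {} \<longrightarrow>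
         (\<exists>V. continuous_on {u..v} V \<and>
              (\<forall>t\<in>{u..v}. (c has_vector_derivative V t) (at t within {u..v})))))"

definition len :: "real \<Rightarrow> real \<Rightarrow> (real \<Rightarrow> real^'n^'n) \<Rightarrow> real" where
  "len a b c = integral {a..b} (\<lambda>t.
     let v = vector_derivative c (at t within {a..b}) in sqrt (gW (c t) v v))"

definition length_minimizing :: "real \<Rightarrow> real \<Rightarrow> (real \<Rightarrow> real^'n^'n) \<Rightarrow> bool" where
  "length_minimizing a b \<gamma> \<longleftrightarrow>
     (\<forall>u v c. pw_C1_curve u v c \<and> c u = \<gamma> a \<and> c v = \<gamma> b \<longrightarrow> len a b \<gamma> \<le> len u v c)"

text \<open>The cut points of \<open>\<gamma> a\<close> along \<open>\<gamma>\<close>, where \<open>a\<close> is the least element of \<open>I\<close>. The geodesic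
  must continue beyond a cut point, so the last point of \<open>I\<close> (if any) never counts as one.\<close>

definition cut_points :: "real set \<Rightarrow> real \<Rightarrow> (real \<Rightarrow> real^'n^'n) \<Rightarrow> (real^'n^'n) set" where
  "cut_points I a \<gamma> = {\<gamma> s |s. s \<in> I \<and> length_minimizing a s \<gamma> \<and> (\<exists>t\<in>I. s < t) \<and>
     (\<forall>t\<in>I. s < t \<longrightarrow> \<not> length_minimizing a t \<gamma>)}"

end

theory Submission
  imports Defs
begin

text \<open>Write \<open>G = lyap A V\<close> for the momentum dual to a velocity \<open>V\<close> at \<open>A\<close>. The Koszul formula gives
  \<open>christoffel A V V = - 2 G A G\<close>, so along a geodesic \<open>G' = - G\<^sup>2\<close> and \<open>G \<gamma> G\<close> is constant. Hence
  \<open>\<gamma> t = (1 + t G) \<gamma>(0) (1 + t G)\<close> with \<open>G\<close> the initial momentum, and \<open>1 + t G\<close> stays positive definite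
  because \<open>\<gamma> t\<close> is nonsingular. Geodesics from \<open>A\<close> to \<open>B\<close> therefore correspond to positive definite
  solutions \<open>T\<close> of \<open>T A T = B\<close>; there is exactly one, by existence and uniqueness of square roots.

  Every geodesic segment is minimizing by a calibration argument: since \<open>G' = - G\<^sup>2\<close> is the
  Hamilton-Jacobi equation for the linear functions \<open>C \<mapsto> tr(G C)\<close>, the derivative of \<open>tr(G(t) c(t))\<close> along
  any curve \<open>c\<close> is at most its squared speed, with equality along \<open>\<gamma>\<close>. Hence there are no cut points.\<close>

subsection \<open>Matrix algebra\<close>

lemma bounded_bilinear_matrix_mul:
  "bounded_bilinear ((**) :: real^'n^'m \<Rightarrow> real^'p^'n \<Rightarrow> real^'p^'m)"
proof -
  have "bilinear ((**) :: real^'n^'m \<Rightarrow> real^'p^'n \<Rightarrow> real^'p^'m)"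
    unfolding bilinear_def
    by (auto intro!: linearI simp: matrix_matrix_mult_def vec_eq_iff algebra_simps sum.distrib sum_distrib_left)
  then show ?thesis by (simp add: bilinear_conv_bounded_bilinear)
qed

interpretation matrix_mul: bounded_bilinear "(**) :: real^'n^'m \<Rightarrow> real^'p^'n \<Rightarrow> real^'p^'m"
  by (rule bounded_bilinear_matrix_mul)

lemma bounded_linear_transpose: "bounded_linear (transpose :: real^'n^'m \<Rightarrow> real^'m^'n)"
proof -
  have "linear (transpose :: real^'n^'m \<Rightarrow> real^'m^'n)"
    by (auto intro!: linearI simp: transpose_def vec_eq_iff)
  then show ?thesis by (simp add: linear_conv_bounded_linear)
qed

lemma transpose_add: "transpose (X + Y) = transpose X + transpose Y"
  and transpose_diff: "transpose (X - Y) = transpose X - transpose Y"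
  and transpose_minus: "transpose (- X) = - transpose X"
  and transpose_zero: "transpose 0 = (0 :: real^'m^'n)"
  for X Y :: "real^'n^'m"
  by (simp_all add: transpose_def vec_eq_iff)

lemmas matrix_ring_simps =
  matrix_mul.add_left matrix_mul.add_right matrix_mul.diff_left matrix_mul.diff_right
  matrix_mul.minus_left matrix_mul.minus_right matrix_mul.scaleR_left matrix_mul.scaleR_right
  matrix_mul_assoc[symmetric]

lemmas transpose_simps =
  transpose_add transpose_diff transpose_minus transpose_zero transpose_scalar matrix_transpose_mul

text \<open>Bridge from traces to the inner product of the matrix type, which is the Frobenius
  product; the metric can then be handled with adjoints and Cauchy-Schwarz.\<close>

lemma trace_matrix_mul_eq_inner: "trace (X ** Y) = transpose X \<bullet> (Y :: real^'n^'m)"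
  for X :: "real^'m^'n"
proof -
  have "trace (X ** Y) = (\<Sum>i\<in>UNIV. \<Sum>k\<in>UNIV. X$i$k * Y$k$i)"
    by (simp add: trace_def matrix_matrix_mult_def)
  also have "\<dots> = (\<Sum>k\<in>UNIV. \<Sum>i\<in>UNIV. X$i$k * Y$k$i)" by (rule sum.swap)
  finally show ?thesis by (simp add: inner_vec_def transpose_def)
qed

lemma inner_transpose: "transpose X \<bullet> transpose Y = X \<bullet> Y" for X Y :: "real^'n^'m"
  by (metis inner_commute trace_matrix_mul_eq_inner trace_mul_sym transpose_transpose)

lemma inner_matrix_mul_left: "(A ** X) \<bullet> Y = X \<bullet> (transpose A ** Y)"
  for A :: "real^'m^'k" and X :: "real^'n^'m" and Y :: "real^'n^'k"
proof -
  have "(A ** X) \<bullet> Y = trace (transpose X ** (transpose A ** Y))"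
    using trace_matrix_mul_eq_inner[of "transpose (A ** X)" Y]
    by (simp add: matrix_transpose_mul matrix_mul_assoc)
  then show ?thesis by (simp add: trace_matrix_mul_eq_inner)
qed

lemma inner_matrix_mul_right: "(X ** A) \<bullet> Y = X \<bullet> (Y ** transpose A)"
  for X :: "real^'m^'k" and A :: "real^'n^'m" and Y :: "real^'n^'k"
  using inner_matrix_mul_left[of "transpose A" "transpose X" "transpose Y"]
  by (metis inner_transpose matrix_transpose_mul transpose_transpose)

lemma Sym_add: "X \<in> Sym \<Longrightarrow> Y \<in> Sym \<Longrightarrow> X + Y \<in> Sym"
  and Sym_diff: "X \<in> Sym \<Longrightarrow> Y \<in> Sym \<Longrightarrow> X - Y \<in> Sym"
  and Sym_scaleR: "X \<in> Sym \<Longrightarrow> r *\<^sub>R X \<in> Sym"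
  and Sym_congruence: "X \<in> Sym \<Longrightarrow> Y \<in> Sym \<Longrightarrow> X ** Y ** X \<in> Sym"
  and Sym_anticommutator: "X \<in> Sym \<Longrightarrow> Y \<in> Sym \<Longrightarrow> X ** Y + Y ** X \<in> Sym"
  and Sym_one: "mat 1 \<in> Sym"
  by (auto simp: Sym_def transpose_simps matrix_mul_assoc add.commute)

lemma SPD_Sym: "A \<in> SPD \<Longrightarrow> A \<in> Sym"
  by (simp add: SPD_def)

lemma Sym_transpose: "A \<in> Sym \<Longrightarrow> transpose A = A"
  by (simp add: Sym_def)

text \<open>Compactness of the unit sphere plus homogeneity. The minimizer itself is returned: the
  value of the form at it is the coercivity constant, and \<open>nonsingular_segment_SPD\<close>
  shows that it is an eigenvector of a symmetric matrix.\<close>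

lemma quadratic_form_attains_min:
  fixes A :: "real^'n^'n"
  obtains x where "norm x = 1" "\<And>y. (x \<bullet> (A *v x)) * (norm y)\<^sup>2 \<le> y \<bullet> (A *v y)"
proof -
  let ?S = "sphere 0 1 :: (real^'n) set"
  have "\<exists>x\<in>?S. \<forall>y\<in>?S. x \<bullet> (A *v x) \<le> y \<bullet> (A *v y)"
    \<comment> \<open>The vector \<open>axis undefined 1\<close> witnesses that the sphere is
      nonempty.\<close>
    by (rule continuous_attains_inf)
      (auto intro!: continuous_intros matrix_vector_mult_linear_continuous_on exI[of _ "axis undefined 1"])
  then obtain x where x: "norm x = 1" "\<And>y. norm y = 1 \<Longrightarrow> x \<bullet> (A *v x) \<le> y \<bullet> (A *v y)"
    by auto
  have "(x \<bullet> (A *v x)) * (norm y)\<^sup>2 \<le> y \<bullet> (A *v y)" for y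
  proof (cases "y = 0")
    case False
    then have "x \<bullet> (A *v x) \<le> (y /\<^sub>R norm y) \<bullet> (A *v (y /\<^sub>R norm y))"
      by (intro x(2)) simp
    also have "\<dots> = (y \<bullet> (A *v y)) / (norm y)\<^sup>2"
      by (simp add: matrix_vector_mult_scaleR power2_eq_square field_simps)
    finally show ?thesis using False by (simp add: field_simps)
  qed simp
  with x(1) show ?thesis using that by blast
qed

lemma SPD_coercive:
  fixes A :: "real^'n^'n"
  assumes "A \<in> SPD"
  obtains m where "m > 0" "\<And>x. m * (norm x)\<^sup>2 \<le> x \<bullet> (A *v x)"
proof -
  obtain x where x: "norm x = 1" "\<And>y. (x \<bullet> (A *v x)) * (norm y)\<^sup>2 \<le> y \<bullet> (A *v y)"
    using quadratic_form_attains_min[of A] by blast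
  have "x \<noteq> 0" using x(1) by auto
  then have "0 < x \<bullet> (A *v x)" using assms by (simp add: SPD_def)
  then show ?thesis using that x(2) by blast
qed

text \<open>Row \<open>i\<close> of \<open>X ** A\<close> is \<open>transpose A *v X$i\<close>.
  Through this splitting, coercivity passes from vectors to matrices.\<close>

lemma inner_matrix_mul_rows:
  "X \<bullet> (X ** A) = (\<Sum>i\<in>UNIV. X$i \<bullet> (transpose A *v X$i))" for A :: "real^'n^'n" and X :: "real^'n^'m"
  by (simp add: inner_vec_def[of X] matrix_matrix_mult_def vector_matrix_mult_def inner_vec_def[of "X$_"] mult.commute)

lemma coercive_matrix_mul_right:
  fixes A :: "real^'n^'n" and X :: "real^'n^'m"
  assumes "A \<in> Sym" and "\<And>x. m * (norm x)\<^sup>2 \<le> x \<bullet> (A *v x)"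
  shows "m * (norm X)\<^sup>2 \<le> X \<bullet> (X ** A)"
proof -
  have "m * (norm X)\<^sup>2 = (\<Sum>i\<in>UNIV. m * (norm (X$i))\<^sup>2)"
    by (simp add: power2_norm_eq_inner inner_vec_def[of X] sum_distrib_left)
  also have "\<dots> \<le> X \<bullet> (X ** A)"
    unfolding inner_matrix_mul_rows using assms by (simp add: Sym_transpose sum_mono del: transpose_matrix_vector)
  finally show ?thesis .
qed

lemma coercive_matrix_mul_left:
  fixes A :: "real^'n^'n" and X :: "real^'m^'n"
  assumes "A \<in> Sym" and "\<And>x. m * (norm x)\<^sup>2 \<le> x \<bullet> (A *v x)"
  shows "m * (norm X)\<^sup>2 \<le> X \<bullet> (A ** X)"
proof -
  have "norm (transpose X) = norm X" by (simp add: norm_eq_sqrt_inner inner_transpose)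
  moreover have "transpose X \<bullet> (transpose X ** A) = X \<bullet> (A ** X)"
    using inner_transpose[of X "A ** X"] assms(1) by (simp add: matrix_transpose_mul Sym_transpose)
  ultimately show ?thesis
    using coercive_matrix_mul_right[OF assms, of "transpose X"] by simp
qed

subsection \<open>The Lyapunov equation\<close>

text \<open>Pair the right-hand side with \<open>G\<close>: coercivity of left and right
  multiplication bounds the product below, Cauchy-Schwarz above. \<open>A\<close> enters only
  through \<open>m\<close>, which makes the bound uniform over nearby matrices.\<close>

lemma lyapunov_bound:
  fixes A G :: "real^'n^'n"
  assumes "A \<in> Sym" and "\<And>x. m * (norm x)\<^sup>2 \<le> x \<bullet> (A *v x)"
  shows "2 * m * norm G \<le> norm (A ** G + G ** A)"
proof (cases "G = 0")
  case False
  have "2 * m * (norm G)\<^sup>2 \<le> G \<bullet> (A ** G + G ** A)"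
    using coercive_matrix_mul_left[OF assms, of G] coercive_matrix_mul_right[OF assms, of G]
    by (simp add: inner_add_right)
  also have "\<dots> \<le> norm G * norm (A ** G + G ** A)" by (rule norm_cauchy_schwarz)
  finally show ?thesis using False by (simp add: power2_eq_square)
qed simp

lemma lyapunov_unique:
  assumes A: "A \<in> SPD" and eq: "A ** G + G ** A = A ** H + H ** A"
  shows "G = H"
proof -
  obtain m where m: "m > 0" "\<And>x. m * (norm x)\<^sup>2 \<le> x \<bullet> (A *v x)"
    using SPD_coercive[OF A] by blast
  have "A ** (G - H) + (G - H) ** A = 0"
    using eq by (simp add: matrix_ring_simps algebra_simps)
  then show ?thesis
    using lyapunov_bound[OF SPD_Sym[OF A] m(2), of "G - H"] m(1) by (simp add: mult_le_0_iff)
qed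

text \<open>An injective endomorphism of a finite-dimensional space is surjective.\<close>

lemma lyapunov_exists:
  fixes A X :: "real^'n^'n"
  assumes "A \<in> SPD"
  shows "\<exists>G. A ** G + G ** A = X"
proof -
  have lin: "linear (\<lambda>G. A ** G + G ** A)"
    by (intro linear_compose_add bounded_linear.linear[OF matrix_mul.bounded_linear_left] bounded_linear.linear[OF matrix_mul.bounded_linear_right])
  have "inj (\<lambda>G. A ** G + G ** A)"
    using lyapunov_unique[OF assms] by (auto intro: injI)
  then have "surj (\<lambda>G. A ** G + G ** A)"
    using linear_injective_imp_surjective[OF lin] by blast
  then show ?thesis using surjD[of "\<lambda>G. A ** G + G ** A" X] by metis
qed

lemma lyap_eqI: "A \<in> SPD \<Longrightarrow> A ** G + G ** A = X \<Longrightarrow> lyap A X = G"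
  unfolding lyap_def using lyapunov_unique by (intro the_equality) auto

lemma lyap_eq: "A \<in> SPD \<Longrightarrow> A ** lyap A X + lyap A X ** A = X"
  using lyapunov_exists lyap_eqI by metis

lemma lyap_Sym: "A \<in> SPD \<Longrightarrow> X \<in> Sym \<Longrightarrow> lyap A X \<in> Sym"
proof -
  assume A: "A \<in> SPD" and X: "X \<in> Sym"
  have "A ** transpose (lyap A X) + transpose (lyap A X) ** A = transpose (A ** lyap A X + lyap A X ** A)"
    using SPD_Sym[OF A] by (simp add: transpose_simps Sym_transpose add.commute)
  also have "\<dots> = X" using A X by (simp add: lyap_eq Sym_transpose)
  finally have "lyap A X = transpose (lyap A X)" by (rule lyap_eqI[OF A])
  then show ?thesis by (simp add: Sym_def)
qed

text \<open>As \<open>A\<close> is symmetric, the Lyapunov operator is its own Frobenius adjoint,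
  and this property passes to its inverse.\<close>

lemma lyap_self_adjoint:
  assumes A: "A \<in> SPD"
  shows "lyap A X \<bullet> Y = X \<bullet> lyap A Y"
proof -
  let ?G = "lyap A X" and ?H = "lyap A Y"
  have "?G \<bullet> Y = ?G \<bullet> (A ** ?H + ?H ** A)" using lyap_eq[OF A] by simp
  also have "\<dots> = (A ** ?G + ?G ** A) \<bullet> ?H"
    using inner_matrix_mul_left[of A ?G ?H] inner_matrix_mul_right[of ?G A ?H]
    by (simp add: inner_add_left inner_add_right Sym_transpose[OF SPD_Sym[OF A]])
  finally show ?thesis using lyap_eq[OF A] by simp
qed

text \<open>A resolvent-type identity, found by applying the Lyapunov operator of \<open>B\<close>
  to the difference. Continuity and derivative of \<open>lyap\<close>, jointly in both arguments,
  are read off from it.\<close>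

lemma lyap_diff_lyap:
  assumes "A \<in> SPD" "B \<in> SPD"
  shows "lyap B Y - lyap A X = lyap B (Y - X - (B - A) ** lyap A X - lyap A X ** (B - A))"
proof -
  let ?G = "lyap A X" and ?H = "lyap B Y"
  have "B ** (?H - ?G) + (?H - ?G) ** B =
      (B ** ?H + ?H ** B) - (A ** ?G + ?G ** A) - (B - A) ** ?G - ?G ** (B - A)"
    by (simp add: matrix_ring_simps algebra_simps)
  then show ?thesis using lyap_eq[OF assms(1)] lyap_eq[OF assms(2)] lyap_eqI[OF assms(2)] by metis
qed

lemma lyap_scaleR: "A \<in> SPD \<Longrightarrow> lyap A (r *\<^sub>R X) = r *\<^sub>R lyap A X"
  by (rule lyap_eqI) (simp_all add: matrix_ring_simps lyap_eq flip: scaleR_add_right)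

lemma lyap_minus: "A \<in> SPD \<Longrightarrow> lyap A (- X) = - lyap A X"
  using lyap_scaleR[of A "-1" X] by simp

section \<open>Continuity and differentiability of Lyapunov solutions\<close>

lemma bounded_bilinear_matrix_vector_mul:
  "bounded_bilinear ((*v) :: real^'n^'m \<Rightarrow> real^'n \<Rightarrow> real^'m)"
  unfolding bilinear_conv_bounded_bilinear[symmetric] bilinear_def
  by (auto intro!: linearI simp: algebra_simps scaleR_matrix_vector_assoc matrix_vector_mult_scaleR)

text \<open>Near the limit the perturbation uses up at most half of the coercivity constant. The
  common constant \<open>m / 2\<close> makes \<open>lyapunov_bound\<close> uniform along the
  filter.\<close>

lemma eventually_coercive:
  fixes A0 :: "real^'n^'n"
  assumes lim: "(A \<longlongrightarrow> A0) F" and m: "m > 0" "\<And>x. m * (norm x)\<^sup>2 \<le> x \<bullet> (A0 *v x)"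
  shows "\<forall>\<^sub>F s in F. \<forall>x. m / 2 * (norm x)\<^sup>2 \<le> x \<bullet> (A s *v x)"
proof -
  obtain K where K: "K > 0" "\<And>(B::real^'n^'n) x. norm (B *v x) \<le> norm B * norm x * K"
    using bounded_bilinear.pos_bounded[OF bounded_bilinear_matrix_vector_mul] by blast
  \<comment> \<open>\<open>K\<close> compares the operator norm with the matrix norm, so within this
    radius the quadratic form changes by at most \<open>m / 2\<close> on unit vectors.\<close>
  have "\<forall>\<^sub>F s in F. norm (A s - A0) < m / (2 * K)"
    using tendstoD[OF lim, of "m / (2 * K)"] m K by (simp add: dist_norm)
  then show ?thesis
  proof eventually_elim
    case (elim s)
    show ?case
    proof
      fix x :: "real^'n"
      have "\<bar>x \<bullet> ((A s - A0) *v x)\<bar> \<le> norm x * norm ((A s - A0) *v x)" by (rule Cauchy_Schwarz_ineq2)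
      also have "\<dots> \<le> norm x * (norm (A s - A0) * norm x * K)" by (intro mult_left_mono K) auto
      also have "\<dots> = (norm (A s - A0) * K) * (norm x)\<^sup>2" by (simp add: power2_eq_square)
      also have "\<dots> \<le> (m / 2) * (norm x)\<^sup>2" using elim K by (intro mult_right_mono) (auto simp: field_simps)
      finally show "m / 2 * (norm x)\<^sup>2 \<le> x \<bullet> (A s *v x)"
        using m(2)[of x] unfolding matrix_vector_mult_diff_rdistrib inner_diff_right
        by (simp only: abs_le_iff times_divide_eq_left) linarith
    qed
  qed
qed

text \<open>This is openness of \<open>SPD\<close> relative to \<open>Sym\<close>; symmetry is
  supplied separately because coercivity does not give it.\<close>

lemma eventually_SPD:
  assumes "(A \<longlongrightarrow> A0) F" "A0 \<in> SPD" "\<forall>\<^sub>F s in F. A s \<in> Sym"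
  shows "\<forall>\<^sub>F s in F. A s \<in> SPD"
proof -
  obtain m where m: "m > 0" "\<And>x. m * (norm x)\<^sup>2 \<le> x \<bullet> (A0 *v x)"
    using SPD_coercive assms(2) by blast
  from eventually_coercive[OF assms(1) m] assms(3) show ?thesis
  proof eventually_elim
    case (elim s)
    have "0 < x \<bullet> (A s *v x)" if "x \<noteq> 0" for x
      using elim(1)[rule_format, of x] m(1) that by (smt (verit) half_gt_zero mult_pos_pos zero_less_norm_iff zero_less_power)
    with elim(2) show ?case by (simp add: SPD_def)
  qed
qed

lemma tendsto_lyap:
  fixes A0 :: "real^'n^'n"
  assumes A: "(A \<longlongrightarrow> A0) F" "A0 \<in> SPD" "\<forall>\<^sub>F s in F. A s \<in> SPD" and X: "(X \<longlongrightarrow> X0) F"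
  shows "((\<lambda>s. lyap (A s) (X s)) \<longlongrightarrow> lyap A0 X0) F"
proof -
  obtain m where m: "m > 0" "\<And>x. m * (norm x)\<^sup>2 \<le> x \<bullet> (A0 *v x)"
    using SPD_coercive assms(2) by blast
  \<comment> \<open>The residual from \<open>lyap_diff_lyap\<close>: the difference to be estimated
    is its Lyapunov solution at \<open>A s\<close>.\<close>
  define R where "R s = X s - X0 - (A s - A0) ** lyap A0 X0 - lyap A0 X0 ** (A s - A0)" for s
  have "(R \<longlongrightarrow> X0 - X0 - (A0 - A0) ** lyap A0 X0 - lyap A0 X0 ** (A0 - A0)) F"
    unfolding R_def by (intro tendsto_intros matrix_mul.tendsto A X)
  then have R: "(R \<longlongrightarrow> 0) F" by (simp add: matrix_mul.zero_left matrix_mul.zero_right)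
  have "((\<lambda>s. lyap (A s) (X s) - lyap A0 X0) \<longlongrightarrow> 0) F"
  proof (rule tendsto_0_le[OF R, of _ "1 / m"])
    show "\<forall>\<^sub>F s in F. norm (lyap (A s) (X s) - lyap A0 X0) \<le> norm (R s) * (1 / m)"
      using eventually_coercive[OF A(1) m] A(3)
    proof eventually_elim
      case (elim s)
      have "2 * (m/2) * norm (lyap (A s) (R s)) \<le> norm (R s)"
        using lyapunov_bound[OF SPD_Sym, of "A s" "m/2" "lyap (A s) (R s)"] elim lyap_eq[of "A s" "R s"] by simp
      moreover have "lyap (A s) (X s) - lyap A0 X0 = lyap (A s) (R s)"
        unfolding R_def by (rule lyap_diff_lyap) (use assms elim in auto)
      ultimately show ?case using m(1) by (simp add: field_simps)
    qed
  qed
  then show ?thesis by (simp add: LIM_zero_iff)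
qed

text \<open>Quotients suit the Lyapunov equation: by linearity, a difference quotient of solutions
  is the solution for a difference quotient of data.\<close>

lemma has_vector_derivative_iff_quotient:
  fixes f :: "real \<Rightarrow> 'a::real_normed_vector"
  shows "(f has_vector_derivative D) (at t within I) \<longleftrightarrow>
    ((\<lambda>s. (f s - f t) /\<^sub>R (s - t)) \<longlongrightarrow> D) (at t within I)"
proof -
  have "norm ((1 / norm (y - t)) *\<^sub>R (f y - (f t + (y - t) *\<^sub>R D))) = norm ((f y - f t) /\<^sub>R (y - t) - D)"
    if "y \<noteq> t" for y
  proof -
    have "f y - (f t + (y - t) *\<^sub>R D) = (y - t) *\<^sub>R ((f y - f t) /\<^sub>R (y - t) - D)"
      using that by (simp add: scaleR_diff_right)
    then show ?thesis using that by simp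
  qed
  then have "\<forall>\<^sub>F y in at t within I. norm ((1 / norm (y - t)) *\<^sub>R (f y - (f t + (y - t) *\<^sub>R D))) =
      norm ((f y - f t) /\<^sub>R (y - t) - D)"
    by (simp add: eventually_at_filter)
  from tendsto_cong[OF this] have "(f has_vector_derivative D) (at t within I) \<longleftrightarrow>
    ((\<lambda>y. norm ((f y - f t) /\<^sub>R (y - t) - D)) \<longlongrightarrow> 0) (at t within I)"
    unfolding has_vector_derivative_def has_derivative_within
      tendsto_norm_zero_iff[symmetric, of "\<lambda>y. (1 / norm (y - t)) *\<^sub>R (f y - (f t + (y - t) *\<^sub>R D))"]
    by (simp only: bounded_linear_scaleR_left simp_thms)
  then show ?thesis by (simp add: tendsto_norm_zero_iff LIM_zero_iff)
qed

text \<open>The value comes from differentiating \<open>A ** G + G ** A = X\<close> and solving for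
  the derivative of \<open>G\<close>. For the proof, the difference quotient of the solutions equals
  \<open>lyap (A s) (Q s)\<close>, and \<open>tendsto_lyap\<close> passes to the limit.\<close>

lemma has_vector_derivative_lyap:
  fixes A :: "real \<Rightarrow> real^'n^'n"
  assumes A: "(A has_vector_derivative A') (at t within I)" and X: "(X has_vector_derivative X') (at t within I)"
    and SPD: "A t \<in> SPD" "\<forall>\<^sub>F s in at t within I. A s \<in> SPD"
  shows "((\<lambda>s. lyap (A s) (X s)) has_vector_derivative
      lyap (A t) (X' - A' ** lyap (A t) (X t) - lyap (A t) (X t) ** A')) (at t within I)"
proof -
  define G where "G = lyap (A t) (X t)"
  define Q where "Q s = (X s - X t) /\<^sub>R (s - t) - ((A s - A t) /\<^sub>R (s - t)) ** G
      - G ** ((A s - A t) /\<^sub>R (s - t))" for s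
  have lim: "(A \<longlongrightarrow> A t) (at t within I)"
    using has_vector_derivative_continuous[OF A] by (simp add: continuous_within)
  have "(Q \<longlongrightarrow> X' - A' ** G - G ** A') (at t within I)"
    unfolding Q_def using A X
    by (intro tendsto_intros matrix_mul.tendsto) (simp_all add: has_vector_derivative_iff_quotient)
  from tendsto_lyap[OF lim SPD this]
  have "((\<lambda>s. lyap (A s) (Q s)) \<longlongrightarrow> lyap (A t) (X' - A' ** G - G ** A')) (at t within I)" .
  note lim_lyap = this
  have ev: "\<forall>\<^sub>F s in at t within I. lyap (A s) (Q s) = (lyap (A s) (X s) - lyap (A t) (X t)) /\<^sub>R (s - t)"
    using SPD(2)
  proof eventually_elim
    case (elim s)
    have Q: "Q s = (X s - X t - (A s - A t) ** G - G ** (A s - A t)) /\<^sub>R (s - t)"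
      unfolding Q_def matrix_mul.scaleR_left matrix_mul.scaleR_right
      by (simp only: scaleR_diff_right[of _ "_ - _ - _"] scaleR_diff_right[of _ "_ - _" "_ ** _"])
    show ?case
      unfolding Q lyap_scaleR[OF elim] lyap_diff_lyap[OF SPD(1) elim] G_def ..
  qed
  show ?thesis
    unfolding has_vector_derivative_iff_quotient G_def[symmetric]
    by (rule Lim_transform_eventually[OF lim_lyap ev[folded G_def]])
qed

subsection \<open>The geodesic equation\<close>

text \<open>By transposition \<open>A ** lyap A X\<close> and \<open>lyap A X ** A\<close> have the
  same product with \<open>lyap A Y\<close>, and they add up to \<open>X\<close>.\<close>

lemma gW_eq_inner_lyap:
  assumes A: "A \<in> SPD" and X: "X \<in> Sym" and Y: "Y \<in> Sym"
  shows "gW A X Y = (lyap A Y \<bullet> X) / 2"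
proof -
  let ?G = "lyap A X" and ?H = "lyap A Y"
  note sym = Sym_transpose[OF SPD_Sym[OF A]] Sym_transpose[OF lyap_Sym[OF A X]] Sym_transpose[OF lyap_Sym[OF A Y]]
  have 1: "gW A X Y = ?H \<bullet> (A ** ?G)"
    using trace_matrix_mul_eq_inner[of ?H "A ** ?G"] by (simp add: gW_def sym matrix_mul_assoc)
  have "?H \<bullet> (A ** ?G) = ?H \<bullet> (?G ** A)"
  proof -
    have "?H \<bullet> (A ** ?G) = (?G ** A) \<bullet> ?H"
      using inner_transpose[of ?H "A ** ?G"] by (simp add: matrix_transpose_mul sym inner_commute)
    then show ?thesis by (simp add: inner_commute)
  qed
  then have "2 * gW A X Y = ?H \<bullet> (A ** ?G + ?G ** A)" using 1 by (simp add: inner_add_right)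
  then show ?thesis by (simp add: lyap_eq[OF A])
qed

lemma gW_self: "A \<in> SPD \<Longrightarrow> X \<in> Sym \<Longrightarrow> gW A X X = lyap A X \<bullet> (A ** lyap A X)"
  using trace_matrix_mul_eq_inner[of "lyap A X" "A ** lyap A X"]
  by (simp add: gW_def matrix_mul_assoc Sym_transpose[OF lyap_Sym])

text \<open>Differentiate \<open>lyap A Y \<bullet> X\<close> in \<open>A\<close>; self-adjointness
  then moves the outer \<open>lyap A\<close> onto \<open>X\<close>.\<close>

lemma dgW_eq:
  assumes A: "A \<in> SPD" and sym: "X \<in> Sym" "Y \<in> Sym" "Z \<in> Sym"
  shows "dgW A Z X Y = - ((Z ** lyap A Y + lyap A Y ** Z) \<bullet> lyap A X) / 2"
proof -
  let ?G = "lyap A Y"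
  have dA: "((\<lambda>s. A + s *\<^sub>R Z) has_vector_derivative Z) (at 0)"
    by (auto intro!: derivative_eq_intros)
  have lim: "((\<lambda>s. A + s *\<^sub>R Z) \<longlongrightarrow> A) (at 0)"
    by (auto intro!: tendsto_eq_intros)
  have ev: "\<forall>\<^sub>F s in at 0. A + s *\<^sub>R Z \<in> SPD"
    by (intro eventually_SPD[OF lim A] always_eventually allI Sym_add Sym_scaleR SPD_Sym[OF A] sym)
  have "((\<lambda>s. lyap (A + s *\<^sub>R Z) Y) has_vector_derivative
      lyap (A + 0 *\<^sub>R Z) (0 - Z ** lyap (A + 0 *\<^sub>R Z) Y - lyap (A + 0 *\<^sub>R Z) Y ** Z)) (at 0)"
    by (rule has_vector_derivative_lyap[OF dA]) (use A ev in auto)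
  moreover have "lyap (A + 0 *\<^sub>R Z) (0 - Z ** lyap (A + 0 *\<^sub>R Z) Y - lyap (A + 0 *\<^sub>R Z) Y ** Z)
      = - lyap A (Z ** ?G + ?G ** Z)"
    using lyap_minus[OF A, of "Z ** ?G + ?G ** Z"] by simp
  ultimately have "((\<lambda>s. lyap (A + s *\<^sub>R Z) Y) has_vector_derivative - lyap A (Z ** ?G + ?G ** Z)) (at 0)"
    by metis
  from bounded_linear.has_vector_derivative[OF bounded_linear_inner_left this, of X]
  have "((\<lambda>s. lyap (A + s *\<^sub>R Z) Y \<bullet> X) has_real_derivative - ((Z ** ?G + ?G ** Z) \<bullet> lyap A X)) (at 0)"
    unfolding has_real_derivative_iff_has_vector_derivative inner_minus_left lyap_self_adjoint[OF A] .
  then have d: "((\<lambda>s. (lyap (A + s *\<^sub>R Z) Y \<bullet> X) / 2) has_real_derivative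
      - ((Z ** ?G + ?G ** Z) \<bullet> lyap A X) / 2) (at 0)"
    by (rule DERIV_cdivide)
  have "\<forall>\<^sub>F s in at 0. gW (A + s *\<^sub>R Z) X Y = (lyap (A + s *\<^sub>R Z) Y \<bullet> X) / 2"
    using ev by eventually_elim (simp add: gW_eq_inner_lyap sym)
  \<comment> \<open>The point 0 is included because the derivative depends on the value there as
    well.\<close>
  then have "\<forall>\<^sub>F s in nhds 0. gW (A + s *\<^sub>R Z) X Y = (lyap (A + s *\<^sub>R Z) Y \<bullet> X) / 2"
    using gW_eq_inner_lyap[OF A sym(1,2)] by (simp add: eventually_nhds_conv_at)
  from DERIV_cong_ev[OF refl this refl] d
  show ?thesis unfolding dgW_def by (metis DERIV_imp_deriv)
qed

text \<open>Adjointness turns each Koszul term into a product with \<open>lyap A Z\<close>. The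
  other factors combine to \<open>A ** (G ** G) + (G ** G) ** A - (V ** G + G ** V)\<close>, which
  is the claimed value after inserting \<open>V = A ** G + G ** A\<close>.\<close>

lemma christoffel_eq:
  assumes A: "A \<in> SPD" and V: "V \<in> Sym"
  defines "G \<equiv> lyap A V"
  shows "christoffel A V V = - (2 *\<^sub>R (G ** A ** G))"
  unfolding christoffel_def
proof (rule the_equality)
  let ?C = "- (2 *\<^sub>R (G ** A ** G))"
  have G: "G \<in> Sym" unfolding G_def using A V by (rule lyap_Sym)
  have C: "?C \<in> Sym"
    using Sym_scaleR[OF Sym_congruence[OF G SPD_Sym[OF A]], of "-2"] by simp
  have eqV: "V = A ** G + G ** A" unfolding G_def using lyap_eq[OF A] by simp
  have koszul: "gW A ?C Z = (dgW A V V Z + dgW A V V Z - dgW A Z V V) / 2" if Z: "Z \<in> Sym" for Z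
  proof -
    let ?H = "lyap A Z"
    note sym = Sym_transpose[OF SPD_Sym[OF A]] Sym_transpose[OF G] Sym_transpose[OF lyap_Sym[OF A Z]]
      Sym_transpose[OF V]
    have "dgW A V V Z = - (?H \<bullet> (V ** G + G ** V)) / 2"
      unfolding dgW_eq[OF A V Z V] G_def[symmetric]
      using inner_matrix_mul_left[of V ?H G] inner_matrix_mul_right[of ?H V G]
      by (simp add: inner_add_left inner_add_right sym)
    moreover have "dgW A Z V V = - (Z \<bullet> (G ** G))"
      unfolding dgW_eq[OF A V V Z] G_def[symmetric]
      using inner_matrix_mul_left[of G Z G] inner_matrix_mul_right[of Z G G]
      by (simp add: inner_add_left inner_add_right sym)
    moreover have "Z \<bullet> (G ** G) = (A ** ?H + ?H ** A) \<bullet> (G ** G)"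
      by (simp add: lyap_eq[OF A])
    then have "Z \<bullet> (G ** G) = ?H \<bullet> (A ** (G ** G) + (G ** G) ** A)"
      using inner_matrix_mul_left[of A ?H "G ** G"] inner_matrix_mul_right[of ?H A "G ** G"]
      by (simp add: inner_add_left inner_add_right sym)
    ultimately have "(dgW A V V Z + dgW A V V Z - dgW A Z V V) / 2
        = (?H \<bullet> (A ** (G ** G) + (G ** G) ** A - (V ** G + G ** V))) / 2"
      by (simp add: inner_diff_right)
    also have "A ** (G ** G) + (G ** G) ** A - (V ** G + G ** V) = ?C"
      unfolding eqV by (simp add: matrix_ring_simps scaleR_2)
    finally show ?thesis using gW_eq_inner_lyap[OF A C Z] by simp
  qed
  then show "?C \<in> Sym \<and> (\<forall>Z\<in>Sym. gW A ?C Z = (dgW A V V Z + dgW A V V Z - dgW A Z V V) / 2)"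
    using C by blast
  fix D assume D: "D \<in> Sym \<and> (\<forall>Z\<in>Sym. gW A D Z = (dgW A V V Z + dgW A V V Z - dgW A Z V V) / 2)"
  define E where "E = D - ?C"
  have E: "E \<in> Sym" unfolding E_def using C D by (intro Sym_diff) auto
  \<comment> \<open>This test direction has \<open>lyap A Z = E\<close>, so equal metric values make
    \<open>E\<close> orthogonal to itself.\<close>
  define Z where "Z = A ** E + E ** A"
  have Z: "Z \<in> Sym" unfolding Z_def using SPD_Sym[OF A] E by (rule Sym_anticommutator)
  have "lyap A Z = E" by (rule lyap_eqI[OF A]) (simp add: Z_def)
  moreover have "gW A D Z = gW A ?C Z"
    by (simp only: D[THEN conjunct2, rule_format, OF Z] koszul[OF Z])
  ultimately have "E \<bullet> D = E \<bullet> ?C"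
    using gW_eq_inner_lyap[OF A C Z] gW_eq_inner_lyap[OF A _ Z, of D] D by simp
  then have "E \<bullet> E = 0" using inner_diff_right[of E D ?C] unfolding E_def[symmetric] by linarith
  then show "D = ?C" unfolding E_def by (simp only: inner_eq_zero_iff right_minus_eq)
qed

section \<open>Integration of the geodesic equation\<close>

lemma has_vector_derivative_zero_constant:
  fixes f :: "real \<Rightarrow> 'a::real_normed_vector"
  assumes "\<And>t. t \<in> {a..b} \<Longrightarrow> (f has_vector_derivative 0) (at t within {a..b})"
    and "s \<in> {a..b}" "t \<in> {a..b}"
  shows "f s = f t"
proof -
  have "(f has_derivative (\<lambda>h. 0)) (at t within {a..b})" if "t \<in> {a..b}" for t
    using assms(1)[OF that] by (simp add: has_vector_derivative_def)
  then show ?thesis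
    using has_derivative_zero_constant[of "{a..b}" f] assms(2,3) convex_real_interval(5) by metis
qed

text \<open>Transposition fixes the curve and therefore its derivative; \<open>a < b\<close> makes
  the one-sided derivatives at the endpoints unique.\<close>

lemma has_vector_derivative_Sym:
  fixes \<gamma> :: "real \<Rightarrow> real^'n^'n"
  assumes "a < b" "\<gamma> ` {a..b} \<subseteq> Sym" "t \<in> {a..b}" "(\<gamma> has_vector_derivative V) (at t within {a..b})"
  shows "V \<in> Sym"
proof -
  have "((\<lambda>s. transpose (\<gamma> s)) has_vector_derivative transpose V) (at t within {a..b})"
    by (rule bounded_linear.has_vector_derivative[OF bounded_linear_transpose assms(4)])
  moreover have eq: "\<gamma> s = transpose (\<gamma> s)" if "s \<in> {a..b}" for s
    using that assms(2) Sym_transpose[of "\<gamma> s"] by (metis image_subset_iff)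
  ultimately have "(\<gamma> has_vector_derivative transpose V) (at t within {a..b})"
    by (intro has_vector_derivative_transform[OF assms(3) eq])
  then have "transpose V = V"
    using assms vector_derivative_unique_within_closed_interval[of a b t \<gamma>] by simp
  then show ?thesis by (simp add: Sym_def)
qed

lemma geodesic_lyap_ODE:
  fixes \<gamma> :: "real \<Rightarrow> real^'n^'n"
  assumes geo: "geodesic_on {a..b} \<gamma>" and "a < b"
  obtains G K where "\<And>t. t \<in> {a..b} \<Longrightarrow> G t \<in> Sym"
    and "\<And>t. t \<in> {a..b} \<Longrightarrow> (\<gamma> has_vector_derivative \<gamma> t ** G t + G t ** \<gamma> t) (at t within {a..b})"
    and "\<And>t. t \<in> {a..b} \<Longrightarrow> (G has_vector_derivative - (G t ** G t)) (at t within {a..b})"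
    and "\<And>t. t \<in> {a..b} \<Longrightarrow> G t ** \<gamma> t ** G t = K"
proof -
  let ?I = "{a..b}"
  obtain V W where VW: "\<And>t. t \<in> ?I \<Longrightarrow> (\<gamma> has_vector_derivative V t) (at t within ?I)"
    "\<And>t. t \<in> ?I \<Longrightarrow> (V has_vector_derivative W t) (at t within ?I)"
    "\<And>t. t \<in> ?I \<Longrightarrow> W t + christoffel (\<gamma> t) (V t) (V t) = 0" and SPD: "\<And>t. t \<in> ?I \<Longrightarrow> \<gamma> t \<in> SPD"
    using geo unfolding geodesic_on_def by blast
  have V: "V t \<in> Sym" if "t \<in> ?I" for t
    using has_vector_derivative_Sym[OF \<open>a < b\<close> _ that VW(1)[OF that]] SPD SPD_Sym by blast
  define G where "G t = lyap (\<gamma> t) (V t)" for t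
  have G: "G t \<in> Sym" if "t \<in> ?I" for t unfolding G_def using that SPD V by (blast intro: lyap_Sym)
  have eqV: "V t = \<gamma> t ** G t + G t ** \<gamma> t" if "t \<in> ?I" for t
    unfolding G_def using lyap_eq[OF SPD[OF that]] by simp
  have eqW: "W t = 2 *\<^sub>R (G t ** \<gamma> t ** G t)" if "t \<in> ?I" for t
    using VW(3)[OF that] christoffel_eq[OF SPD V, OF that that] by (simp add: G_def)
  have d\<gamma>: "(\<gamma> has_vector_derivative \<gamma> t ** G t + G t ** \<gamma> t) (at t within ?I)" if "t \<in> ?I" for t
    using VW(1)[OF that] eqV[OF that] by simp
  have dG: "(G has_vector_derivative - (G t ** G t)) (at t within ?I)" if "t \<in> ?I" for t
  proof -
    have "\<forall>\<^sub>F s in at t within ?I. \<gamma> s \<in> SPD"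
      using SPD by (auto simp: eventually_at_filter)
    from has_vector_derivative_lyap[OF VW(1,2) SPD this, OF that that that]
    have "(G has_vector_derivative lyap (\<gamma> t) (W t - V t ** G t - G t ** V t)) (at t within ?I)"
      unfolding G_def .
    \<comment> \<open>After inserting \<open>V\<close> and \<open>W\<close>, the products
      \<open>G t ** \<gamma> t ** G t\<close> cancel and
      \<open>- (\<gamma> t ** G t ** G t + G t ** G t ** \<gamma> t)\<close> remains.\<close>
    moreover have "lyap (\<gamma> t) (W t - V t ** G t - G t ** V t) = - (G t ** G t)"
      by (rule lyap_eqI[OF SPD[OF that]])
        (simp add: eqV[OF that] eqW[OF that] matrix_ring_simps scaleR_2)
    ultimately show ?thesis by simp
  qed
  \<comment> \<open>In the product rule the two terms from differentiating \<open>\<gamma>\<close>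
    cancel those from differentiating the outer factors.\<close>
  have dK: "((\<lambda>t. G t ** \<gamma> t ** G t) has_vector_derivative 0) (at t within ?I)" if "t \<in> ?I" for t
    by (rule matrix_mul.has_vector_derivative[OF matrix_mul.has_vector_derivative[OF dG d\<gamma>] dG,
          OF that that that, THEN has_vector_derivative_eq_rhs])
      (simp add: matrix_ring_simps)
  show ?thesis
  proof (rule that[of G "G a ** \<gamma> a ** G a"])
    fix t assume t: "t \<in> ?I"
    then show "G t \<in> Sym" "(\<gamma> has_vector_derivative \<gamma> t ** G t + G t ** \<gamma> t) (at t within ?I)"
      "(G has_vector_derivative - (G t ** G t)) (at t within ?I)"
      using G d\<gamma> dG by blast+
    show "G t ** \<gamma> t ** G t = G a ** \<gamma> a ** G a"
      using has_vector_derivative_zero_constant[OF dK, of t a] t by simp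
  qed
qed

lemma congruence_expand:
  "(mat 1 + t *\<^sub>R G) ** A ** (mat 1 + t *\<^sub>R G) = A + t *\<^sub>R (A ** G + G ** A) + t\<^sup>2 *\<^sub>R (G ** A ** G)"
  for G A :: "real^'n^'n"
  by (simp only: matrix_ring_simps scaleR_add_right power2_eq_square scaleR_scaleR matrix_mul_lid matrix_mul_rid add_ac)

text \<open>The velocity \<open>U\<close> has constant derivative \<open>2 *\<^sub>R K\<close>, so
  the curve is quadratic in time. With \<open>U\<close> and \<open>K\<close> evaluated at
  \<open>a\<close>, its coefficients are those of \<open>congruence_expand\<close>.\<close>

lemma geodesic_explicit:
  fixes \<gamma> :: "real \<Rightarrow> real^'n^'n"
  assumes geo: "geodesic_on {a..b} \<gamma>" and "a < b"
  obtains G where "G \<in> Sym"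
    "\<And>t. t \<in> {a..b} \<Longrightarrow> \<gamma> t = (mat 1 + (t - a) *\<^sub>R G) ** \<gamma> a ** (mat 1 + (t - a) *\<^sub>R G)"
proof -
  let ?I = "{a..b}"
  obtain G K where G: "\<And>t. t \<in> ?I \<Longrightarrow> G t \<in> Sym"
    and d\<gamma>: "\<And>t. t \<in> ?I \<Longrightarrow> (\<gamma> has_vector_derivative \<gamma> t ** G t + G t ** \<gamma> t) (at t within ?I)"
    and dG: "\<And>t. t \<in> ?I \<Longrightarrow> (G has_vector_derivative - (G t ** G t)) (at t within ?I)"
    and K: "\<And>t. t \<in> ?I \<Longrightarrow> G t ** \<gamma> t ** G t = K"
    using geodesic_lyap_ODE[OF assms] by metis
  define U where "U t = \<gamma> t ** G t + G t ** \<gamma> t" for t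
  have a: "a \<in> ?I" using \<open>a < b\<close> by simp
  have dU: "(U has_vector_derivative 2 *\<^sub>R K) (at t within ?I)" if "t \<in> ?I" for t
    unfolding U_def
    by (rule has_vector_derivative_add[OF matrix_mul.has_vector_derivative[OF d\<gamma> dG] matrix_mul.has_vector_derivative[OF dG d\<gamma>],
          OF that that that that, THEN has_vector_derivative_eq_rhs])
      (simp add: K[OF that, symmetric] matrix_ring_simps scaleR_2)
  have dU0: "((\<lambda>t. U t - (2 * (t - a)) *\<^sub>R K) has_vector_derivative 0) (at t within ?I)" if "t \<in> ?I" for t
    using dU[OF that] by (auto intro!: derivative_eq_intros)
  have U: "U t = U a + (2 * (t - a)) *\<^sub>R K" if "t \<in> ?I" for t
    using has_vector_derivative_zero_constant[OF dU0 that a] by (simp add: diff_eq_eq)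
  have d0: "((\<lambda>t. \<gamma> t - (t - a) *\<^sub>R U a - (t - a)\<^sup>2 *\<^sub>R K) has_vector_derivative 0) (at t within ?I)" if "t \<in> ?I" for t
    using d\<gamma>[OF that, folded U_def] unfolding U[OF that] by (auto intro!: derivative_eq_intros)
  have eq: "\<gamma> t = \<gamma> a + (t - a) *\<^sub>R U a + (t - a)\<^sup>2 *\<^sub>R K" if "t \<in> ?I" for t
    using has_vector_derivative_zero_constant[OF d0 that a] by (simp add: diff_eq_eq add_ac)
  show ?thesis
  proof (rule that[of "G a"])
    show "G a \<in> Sym" using G a by blast
    fix t assume "t \<in> ?I"
    from eq[OF this] show "\<gamma> t = (mat 1 + (t - a) *\<^sub>R G a) ** \<gamma> a ** (mat 1 + (t - a) *\<^sub>R G a)"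
      unfolding congruence_expand K[OF a, symmetric] U_def .
  qed
qed

subsection \<open>Square roots and transport maps\<close>

lemma SPD_inj: "A \<in> SPD \<Longrightarrow> A *v x = 0 \<Longrightarrow> x = 0"
  by (force simp: SPD_def)

lemma SPD_one: "mat 1 \<in> SPD"
  by (simp add: SPD_def Sym_one)

lemma SPD_add: "A \<in> SPD \<Longrightarrow> B \<in> SPD \<Longrightarrow> A + B \<in> SPD"
  by (auto simp: SPD_def Sym_add matrix_vector_mult_add_rdistrib inner_add_right add_pos_pos)

lemma SPD_scaleR: "A \<in> SPD \<Longrightarrow> 0 < r \<Longrightarrow> r *\<^sub>R A \<in> SPD"
  by (simp add: SPD_def Sym_scaleR flip: scaleR_matrix_vector_assoc)

lemma inner_Sym_mult: "X \<in> Sym \<Longrightarrow> x \<bullet> (X *v y) = (X *v x) \<bullet> y"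
  by (metis Sym_transpose dot_lmul_matrix transpose_matrix_vector)

lemma SPD_congruence:
  assumes "A \<in> SPD" "X \<in> Sym" "\<And>x. X *v x = 0 \<Longrightarrow> x = 0"
  shows "X ** A ** X \<in> SPD"
proof -
  have "0 < x \<bullet> ((X ** A ** X) *v x)" if "x \<noteq> 0" for x
  proof -
    have "x \<bullet> ((X ** A ** X) *v x) = (X *v x) \<bullet> (A *v (X *v x))"
      using inner_Sym_mult[OF assms(2)] by (simp flip: matrix_vector_mul_assoc)
    then show ?thesis using assms(1,3) that by (auto simp: SPD_def)
  qed
  then show ?thesis using assms(1,2) by (simp add: SPD_def Sym_congruence)
qed

lemma SPD_inverse:
  fixes A :: "real^'n^'n"
  assumes "A \<in> SPD"
  obtains B where "B \<in> SPD" "A ** B = mat 1" "B ** A = mat 1"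
proof -
  obtain B where BA: "B ** A = mat 1"
    using matrix_left_invertible_ker[of A] SPD_inj[OF assms] by blast
  then have AB: "A ** B = mat 1" using matrix_left_right_inverse by blast
  have "transpose B ** A = mat 1"
    using arg_cong[OF AB, of transpose] by (simp add: matrix_transpose_mul Sym_transpose[OF SPD_Sym[OF assms]])
  then have "transpose B = B"
    using AB by (metis matrix_mul_assoc matrix_mul_lid matrix_mul_rid)
  moreover have "0 < x \<bullet> (B *v x)" if "x \<noteq> 0" for x
  proof -
    have x: "A *v (B *v x) = x" by (simp add: matrix_vector_mul_assoc AB)
    then have "B *v x \<noteq> 0" using that by auto
    then have "0 < (B *v x) \<bullet> (A *v (B *v x))" using assms by (simp add: SPD_def)
    then show ?thesis by (simp add: x inner_commute)
  qed
  ultimately have "B \<in> SPD" by (simp add: SPD_def Sym_def)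
  then show ?thesis using that AB BA by blast
qed

text \<open>Both matrices solve one Lyapunov equation with coefficient \<open>S + T\<close>: the
  mixed products coincide and the squares agree by assumption.\<close>

lemma SPD_sqrt_unique:
  assumes "S \<in> SPD" "T \<in> SPD" "S ** S = T ** T"
  shows "S = T"
proof -
  have "(S + T) ** S + S ** (S + T) = (S + T) ** T + T ** (S + T)"
    using assms(3) by (simp add: matrix_ring_simps add_ac)
  then show ?thesis by (rule lyapunov_unique[OF SPD_add[OF assms(1,2)]])
qed

text \<open>A mixed estimate, proved row by row: operator norm for \<open>Z\<close>, Frobenius norm
  for \<open>D\<close>. The square root iteration contracts in the Frobenius metric with a factor
  that is an operator norm bound.\<close>

lemma norm_matrix_mul_right_le:
  fixes D :: "real^'n^'m" and Z :: "real^'n^'n"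
  assumes "Z \<in> Sym" "\<And>x. norm (Z *v x) \<le> r * norm x" "0 \<le> r"
  shows "norm (D ** Z) \<le> r * norm D"
proof -
  have row: "(D ** Z) $ i = transpose Z *v (D $ i)" for i
    by (simp add: vec_eq_iff matrix_matrix_mult_def vector_matrix_mult_def mult.commute)
  have "norm (D ** Z) = L2_set (\<lambda>i. norm (Z *v (D $ i))) UNIV"
    unfolding norm_vec_def[of "D ** Z"] row Sym_transpose[OF assms(1)] ..
  also have "\<dots> \<le> L2_set (\<lambda>i. r * norm (D $ i)) UNIV"
    by (rule L2_set_mono) (use assms in auto)
  also have "\<dots> = r * norm D"
    by (simp add: norm_vec_def[of D] L2_set_right_distrib assms(3))
  finally show ?thesis .
qed

lemma norm_matrix_mul_left_le:
  fixes D :: "real^'m^'n" and Z :: "real^'n^'n"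
  assumes "Z \<in> Sym" "\<And>x. norm (Z *v x) \<le> r * norm x" "0 \<le> r"
  shows "norm (Z ** D) \<le> r * norm D"
proof -
  have tr: "norm (transpose X) = norm X" for X :: "real^'m^'n"
    by (simp add: norm_eq_sqrt_inner inner_transpose)
  show ?thesis
    using norm_matrix_mul_right_le[OF assms, of "transpose D"] tr[of D] tr[of "Z ** D"]
    by (simp add: matrix_transpose_mul Sym_transpose[OF assms(1)])
qed

lemma closed_Sym: "closed (Sym :: (real^'n^'n) set)"
  unfolding Sym_def
  by (intro closed_Collect_eq linear_continuous_on bounded_linear_transpose continuous_on_id)

text \<open>If \<open>S\<^sup>2 = mat 1 - C\<close>, then \<open>Y = mat 1 - S\<close> is a fixed point of \<open>Y \<mapsto> (C + Y\<^sup>2) / 2\<close>, which is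
  a contraction when the operator norm of \<open>C\<close> is less than 1.\<close>

lemma sqrt_near_one:
  fixes C :: "real^'n^'n"
  assumes C: "C \<in> Sym" "\<And>x. norm (C *v x) \<le> r * norm x" and r: "0 \<le> r" "r < 1"
  obtains S where "S \<in> SPD" "S ** S = mat 1 - C"
proof -
  \<comment> \<open>The bound \<open>r\<close> of \<open>C\<close> also serves for the invariant
    set, because \<open>(r + r * r) / 2 \<le> r\<close>.\<close>
  define M :: "(real^'n^'n) set" where "M = {Y \<in> Sym. \<forall>x. norm (Y *v x) \<le> r * norm x}"
  define f :: "real^'n^'n \<Rightarrow> real^'n^'n" where "f Y = (1 / 2) *\<^sub>R (C + Y ** Y)" for Y
  have "\<exists>!Y\<in>M. f Y = Y"
  proof (rule Banach_fix[OF _ _ r])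
    have "M = Sym \<inter> (\<Inter>x. {Y. norm (Y *v x) \<le> r * norm x})" by (auto simp: M_def)
    moreover have "closed {Y :: real^'n^'n. norm (Y *v x) \<le> r * norm x}" for x
      by (intro closed_Collect_le continuous_intros linear_continuous_on
          bounded_bilinear.bounded_linear_left[OF bounded_bilinear_matrix_vector_mul])
    ultimately show "complete M" by (simp add: complete_eq_closed closed_Int closed_INT closed_Sym)
    show "M \<noteq> {}" using C by (auto simp: M_def)
    show "f ` M \<subseteq> M"
    proof (clarsimp simp: M_def, intro conjI allI)
      fix Y :: "real^'n^'n" assume Y: "Y \<in> Sym" "\<forall>x. norm (Y *v x) \<le> r * norm x"
      have "Y ** Y \<in> Sym" using Y(1) Sym_congruence[OF Y(1) Sym_one] by simp
      then show "f Y \<in> Sym" unfolding f_def by (intro Sym_scaleR Sym_add C)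
      fix x
      have "norm (f Y *v x) = norm (C *v x + Y *v (Y *v x)) / 2"
        by (simp add: f_def matrix_vector_mult_add_rdistrib matrix_vector_mul_assoc flip: scaleR_matrix_vector_assoc)
      also have "\<dots> \<le> (norm (C *v x) + norm (Y *v (Y *v x))) / 2"
        by (simp add: norm_triangle_ineq)
      also have "\<dots> \<le> (r * norm x + r * norm x) / 2"
      proof -
        have "norm (Y *v (Y *v x)) \<le> r * norm (Y *v x)" using Y(2) by blast
        also have "\<dots> \<le> r * (r * norm x)" using Y(2) r by (intro mult_left_mono) auto
        also have "\<dots> \<le> r * (1 * norm x)" using r by (intro mult_left_mono mult_right_mono) auto
        finally show ?thesis using C(2)[of x] by simp
      qed
      finally show "norm (f Y *v x) \<le> r * norm x" by simp
    qed
    fix Y Z :: "real^'n^'n" assume "Y \<in> M" "Z \<in> M"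
    then have Y: "Y \<in> Sym" "\<And>x. norm (Y *v x) \<le> r * norm x" and Z: "Z \<in> Sym" "\<And>x. norm (Z *v x) \<le> r * norm x"
      by (auto simp: M_def)
    \<comment> \<open>This factors the difference of squares without commutativity; each summand
      contributes \<open>r / 2\<close> to the contraction factor.\<close>
    have "Y ** (Y - Z) + (Y - Z) ** Z = (C + Y ** Y) - (C + Z ** Z)"
      by (simp add: matrix_ring_simps)
    then have "f Y - f Z = (1 / 2) *\<^sub>R (Y ** (Y - Z) + (Y - Z) ** Z)"
      by (simp only: f_def scaleR_diff_right)
    then have "dist (f Y) (f Z) = norm (Y ** (Y - Z) + (Y - Z) ** Z) / 2" by (simp add: dist_norm)
    also have "\<dots> \<le> (norm (Y ** (Y - Z)) + norm ((Y - Z) ** Z)) / 2" by (simp add: norm_triangle_ineq)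
    also have "\<dots> \<le> (r * norm (Y - Z) + r * norm (Y - Z)) / 2"
      using norm_matrix_mul_left_le[OF Y r(1), of "Y - Z"] norm_matrix_mul_right_le[OF Z r(1), of "Y - Z"]
      by simp
    finally show "dist (f Y) (f Z) \<le> r * dist Y Z" by (simp add: dist_norm)
  qed
  then obtain Y where Y: "Y \<in> Sym" "\<And>x. norm (Y *v x) \<le> r * norm x" and fix_Y: "f Y = Y"
    by (auto simp: M_def)
  have "2 *\<^sub>R f Y = C + Y ** Y" by (simp add: f_def)
  then have "Y + Y = C + Y ** Y" using fix_Y by (simp add: scaleR_2)
  then have "Y ** Y = Y + Y - C" by simp
  then have "(mat 1 - Y) ** (mat 1 - Y) = mat 1 - C" by (simp add: matrix_ring_simps)
  moreover have "mat 1 - Y \<in> SPD"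
  proof -
    have "0 < x \<bullet> ((mat 1 - Y) *v x)" if "x \<noteq> 0" for x
    proof -
      have "x \<bullet> (Y *v x) \<le> norm x * norm (Y *v x)" by (rule norm_cauchy_schwarz)
      also have "\<dots> \<le> norm x * (r * norm x)" using Y(2) by (intro mult_left_mono) auto
      also have "\<dots> = r * (norm x)\<^sup>2" by (simp add: power2_eq_square)
      also have "\<dots> < (norm x)\<^sup>2" using r that by simp
      finally show ?thesis
        by (simp add: matrix_vector_mult_diff_rdistrib inner_diff_right power2_norm_eq_inner)
    qed
    then show ?thesis using Y(1) by (simp add: SPD_def Sym_diff Sym_one)
  qed
  ultimately show ?thesis using that by blast
qed

text \<open>A suitable multiple of \<open>B\<close> lies within operator distance less than 1 of the
  identity, where \<open>sqrt_near_one\<close> applies; the root is then scaled back.\<close>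

lemma SPD_sqrt:
  fixes B :: "real^'n^'n"
  assumes B: "B \<in> SPD"
  obtains S where "S \<in> SPD" "S ** S = B"
proof -
  obtain m where m: "m > 0" "\<And>x. m * (norm x)\<^sup>2 \<le> x \<bullet> (B *v x)"
    using SPD_coercive[OF B] by blast
  obtain M0 where M0: "M0 > 0" "\<And>x. norm (B *v x) \<le> norm x * M0"
    using bounded_linear.pos_bounded[OF matrix_vector_mul_bounded_linear[of B]] by blast
  \<comment> \<open>Adding \<open>m\<close> guarantees \<open>m \<le> M\<close>, so that the
    radicand of \<open>r\<close> below is nonnegative.\<close>
  define M where "M = M0 + m"
  have M: "m \<le> M" "0 < M" using M0(1) m(1) by (auto simp: M_def)
  have BM: "norm (B *v x) \<le> M * norm x" for x
    using M0(2)[of x] m(1) by (simp add: M_def algebra_simps) (smt (verit) mult_nonneg_nonneg norm_ge_zero)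
  \<comment> \<open>This minimizes \<open>1 - 2 * c * m + c\<^sup>2 * M\<^sup>2\<close>, the bound
    obtained for the squared operator norm of \<open>mat 1 - c *\<^sub>R B\<close>; the minimum is
    the square of \<open>r\<close>.\<close>
  define c where "c = m / M\<^sup>2"
  have c: "c > 0" using m(1) M by (simp add: c_def)
  define r where "r = sqrt (1 - m\<^sup>2 / M\<^sup>2)"
  have mM: "0 \<le> 1 - m\<^sup>2 / M\<^sup>2" "1 - m\<^sup>2 / M\<^sup>2 < 1"
    using M m(1) by (auto simp: power_mono)
  define C where "C = mat 1 - c *\<^sub>R B"
  have "norm (C *v x) \<le> r * norm x" for x
  proof -
    have Cx: "C *v x = x - c *\<^sub>R (B *v x)"
      by (simp add: C_def matrix_vector_mult_diff_rdistrib scaleR_matrix_vector_assoc)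
    have "(norm (C *v x))\<^sup>2 = (norm x)\<^sup>2 - 2 * c * (x \<bullet> (B *v x)) + c\<^sup>2 * (norm (B *v x))\<^sup>2"
      unfolding Cx power2_norm_eq_inner
      by (simp add: inner_diff_left inner_diff_right inner_commute algebra_simps power2_eq_square)
    also have "\<dots> \<le> (norm x)\<^sup>2 - 2 * c * (m * (norm x)\<^sup>2) + c\<^sup>2 * (M * norm x)\<^sup>2"
      using m(2)[of x] c BM[of x] by (intro add_mono diff_mono mult_left_mono power_mono) auto
    also have "\<dots> = (1 - 2 * c * m + c\<^sup>2 * M\<^sup>2) * (norm x)\<^sup>2"
      by (simp add: algebra_simps power_mult_distrib)
    also have "1 - 2 * c * m + c\<^sup>2 * M\<^sup>2 = 1 - m\<^sup>2 / M\<^sup>2"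
      using M by (simp add: c_def field_simps power2_eq_square)
    also have "(1 - m\<^sup>2 / M\<^sup>2) * (norm x)\<^sup>2 = (r * norm x)\<^sup>2"
      using mM by (simp add: r_def power_mult_distrib)
    finally show ?thesis
      using mM by (auto intro: power2_le_imp_le simp: r_def)
  qed
  moreover have "C \<in> Sym" unfolding C_def by (intro Sym_diff Sym_one Sym_scaleR SPD_Sym B)
  moreover have "0 \<le> r" "r < 1" using mM by (auto simp: r_def real_sqrt_lt_1_iff)
  ultimately obtain S where S: "S \<in> SPD" "S ** S = mat 1 - C" using sqrt_near_one by blast
  show ?thesis
  proof (rule that[of "(1 / sqrt c) *\<^sub>R S"])
    show "(1 / sqrt c) *\<^sub>R S \<in> SPD" using S(1) c by (intro SPD_scaleR) auto
    show "((1 / sqrt c) *\<^sub>R S) ** ((1 / sqrt c) *\<^sub>R S) = B"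
      using c S(2) by (simp add: matrix_mul.scaleR_left matrix_mul.scaleR_right C_def)
  qed
qed

text \<open>\<open>T\<close> is the optimal transport map between the centred Gaussians with covariances \<open>A\<close> and \<open>B\<close>.\<close>

lemma transport_map_exists:
  fixes A B :: "real^'n^'n"
  assumes A: "A \<in> SPD" and B: "B \<in> SPD"
  obtains T where "T \<in> SPD" "T ** A ** T = B"
proof -
  obtain R where R: "R \<in> SPD" "R ** R = A" using SPD_sqrt[OF A] by blast
  obtain Q where Q: "Q \<in> SPD" "R ** Q = mat 1" "Q ** R = mat 1" using SPD_inverse[OF R(1)] by blast
  have "R ** B ** R \<in> SPD" using SPD_congruence[OF B SPD_Sym] R(1) SPD_inj by blast
  then obtain S where S: "S \<in> SPD" "S ** S = R ** B ** R" using SPD_sqrt by blast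
  \<comment> \<open>With \<open>R\<close> the root of \<open>A\<close> and \<open>Q\<close> its
    inverse, the witness is the classical A^(-1/2) (A^(1/2) B A^(1/2))^(1/2) A^(-1/2).\<close>
  show ?thesis
  proof (rule that[of "Q ** S ** Q"])
    show "Q ** S ** Q \<in> SPD" using SPD_congruence[OF S(1) SPD_Sym] Q(1) SPD_inj by blast
    have "(Q ** S ** Q) ** A ** (Q ** S ** Q) = Q ** S ** (Q ** R) ** (R ** Q) ** S ** Q"
      unfolding R(2)[symmetric] by (simp only: matrix_mul_assoc)
    also have "\<dots> = Q ** (S ** S) ** Q" by (simp add: Q matrix_mul_assoc)
    also have "\<dots> = (Q ** R) ** B ** (R ** Q)" by (simp add: S matrix_mul_assoc)
    finally show "(Q ** S ** Q) ** A ** (Q ** S ** Q) = B" by (simp add: Q)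
  qed
qed

text \<open>Congruence by the root \<open>R\<close> of \<open>A\<close> turns
  \<open>X ** A ** X\<close> into the square of \<open>R ** X ** R\<close>, so uniqueness of square
  roots applies.\<close>

lemma transport_map_unique:
  fixes A S T :: "real^'n^'n"
  assumes A: "A \<in> SPD" and S: "S \<in> SPD" and T: "T \<in> SPD" and eq: "S ** A ** S = T ** A ** T"
  shows "S = T"
proof -
  obtain R where R: "R \<in> SPD" "R ** R = A" using SPD_sqrt[OF A] by blast
  obtain Q where Q: "Q \<in> SPD" "R ** Q = mat 1" "Q ** R = mat 1" using SPD_inverse[OF R(1)] by blast
  have sq: "(R ** X ** R) ** (R ** X ** R) = R ** (X ** A ** X) ** R" for X
    unfolding R(2)[symmetric] by (simp only: matrix_mul_assoc)
  have "R ** S ** R \<in> SPD" "R ** T ** R \<in> SPD"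
    using SPD_congruence[OF _ SPD_Sym[OF R(1)] SPD_inj[OF R(1)]] S T by blast+
  then have "R ** S ** R = R ** T ** R" by (rule SPD_sqrt_unique) (simp only: sq eq)
  then have "Q ** (R ** S ** R) ** Q = Q ** (R ** T ** R) ** Q" by simp
  then have "(Q ** R) ** S ** (R ** Q) = (Q ** R) ** T ** (R ** Q)" by (simp only: matrix_mul_assoc)
  then show ?thesis by (simp add: Q)
qed

text \<open>The least eigenvalue \<open>l\<close> of \<open>G\<close> decides: were
  \<open>1 + s * l\<close> not positive, the matrix would be singular at time
  \<open>- 1 / l\<close>, which lies in the segment.\<close>

lemma nonsingular_segment_SPD:
  fixes G :: "real^'n^'n"
  assumes G: "G \<in> Sym" and s: "0 \<le> s"
    and inj: "\<And>t x. 0 \<le> t \<Longrightarrow> t \<le> s \<Longrightarrow> (mat 1 + t *\<^sub>R G) *v x = 0 \<Longrightarrow> x = 0"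
  shows "mat 1 + s *\<^sub>R G \<in> SPD"
proof -
  obtain x where x: "norm x = 1" "\<And>y. (x \<bullet> (G *v x)) * (norm y)\<^sup>2 \<le> y \<bullet> (G *v y)"
    using quadratic_form_attains_min[of G] by blast
  define l where "l = x \<bullet> (G *v x)"
  define y where "y = G *v x - l *\<^sub>R x"
  have "x \<noteq> 0" using x(1) by auto
  have "y = 0"
  proof (rule ccontr)
    \<comment> \<open>otherwise moving from \<open>x\<close> in the direction \<open>- y\<close> would decrease the Rayleigh quotient\<close>
    assume "y \<noteq> 0"
    define q where "q = y \<bullet> (G *v y) - l * (y \<bullet> y)"
    have ge: "0 \<le> 2 * e * (y \<bullet> y) + e\<^sup>2 * q" for e
    proof -
      have xx: "x \<bullet> x = 1" using x(1) by (simp add: norm_eq_1)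
      have n: "(norm (x + e *\<^sub>R y))\<^sup>2 = 1 + 2 * e * (x \<bullet> y) + e\<^sup>2 * (y \<bullet> y)"
        unfolding power2_norm_eq_inner
        by (simp add: xx inner_add_left inner_add_right inner_commute power2_eq_square algebra_simps)
      have g: "(x + e *\<^sub>R y) \<bullet> (G *v (x + e *\<^sub>R y)) = l + 2 * e * (y \<bullet> (G *v x)) + e\<^sup>2 * (y \<bullet> (G *v y))"
        using inner_Sym_mult[OF G, of x y]
        by (simp add: l_def matrix_vector_right_distrib matrix_vector_mult_scaleR inner_add_left inner_add_right
            inner_commute power2_eq_square algebra_simps)
      have "y \<bullet> y = y \<bullet> (G *v x) - l * (x \<bullet> y)"
        by (subst (2) y_def) (simp add: inner_diff_right inner_commute)
      then have yG: "y \<bullet> (G *v x) = y \<bullet> y + l * (x \<bullet> y)" by simp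
      have "l * (norm (x + e *\<^sub>R y))\<^sup>2 \<le> (x + e *\<^sub>R y) \<bullet> (G *v (x + e *\<^sub>R y))"
        unfolding l_def by (rule x(2))
      then show ?thesis unfolding n g yG q_def by (simp add: algebra_simps)
    qed
    have yy: "y \<bullet> y > 0" using \<open>y \<noteq> 0\<close> by simp
    define p where "p = \<bar>q\<bar> + 1"
    have p: "p > 0" "q \<le> p" by (auto simp: p_def)
    \<comment> \<open>As \<open>p\<close> is positive and at least \<open>q\<close>, this choice
      makes the quadratic term at most half the size of the negative linear term.\<close>
    define e where "e = - (y \<bullet> y) / p"
    have "e\<^sup>2 * q \<le> e\<^sup>2 * p" using p by (intro mult_left_mono) auto
    also have "\<dots> = - e * (y \<bullet> y)" using p by (simp add: e_def power2_eq_square)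
    finally have "0 \<le> e * (y \<bullet> y)" using ge[of e] by simp
    moreover have "e < 0" using yy p by (simp add: e_def divide_neg_pos)
    ultimately show False using yy by (simp add: zero_le_mult_iff)
  qed
  then have Gx: "G *v x = l *\<^sub>R x" by (simp add: y_def)
  have pos: "0 < 1 + s * l"
  proof (rule ccontr)
    assume neg: "\<not> 0 < 1 + s * l"
    then have "l < 0" using s by (smt (verit) mult_nonneg_nonneg)
    have "(mat 1 + (- 1 / l) *\<^sub>R G) *v x = 0"
      using \<open>l < 0\<close> unfolding matrix_vector_mult_add_rdistrib scaleR_matrix_vector_assoc[symmetric] Gx by simp
    moreover have "0 \<le> - 1 / l" "- 1 / l \<le> s" using \<open>l < 0\<close> neg by (auto simp: field_simps)
    ultimately show False using inj \<open>x \<noteq> 0\<close> by blast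
  qed
  have "0 < z \<bullet> ((mat 1 + s *\<^sub>R G) *v z)" if "z \<noteq> 0" for z
  proof -
    have "0 < (1 + s * l) * (norm z)\<^sup>2" using pos that by simp
    also have "\<dots> = z \<bullet> z + s * (l * (norm z)\<^sup>2)" by (simp add: power2_norm_eq_inner algebra_simps)
    also have "\<dots> \<le> z \<bullet> z + s * (z \<bullet> (G *v z))"
      using x(2)[of z] s by (intro add_mono mult_left_mono) (auto simp: l_def)
    finally show ?thesis
      by (simp add: matrix_vector_mult_add_rdistrib inner_add_right flip: scaleR_matrix_vector_assoc)
  qed
  then show ?thesis using G by (simp add: SPD_def Sym_add Sym_one Sym_scaleR)
qed

subsection \<open>Geodesics between two points and speed of curves\<close>

text \<open>Interpolate linearly between the identity and the transport map \<open>T\<close>;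
  convexity keeps \<open>M t\<close> positive definite, and the curve is the congruence of
  \<open>A\<close> by \<open>M t\<close>.\<close>

lemma geodesic_joining_exists:
  fixes A B :: "real^'n^'n"
  assumes A: "A \<in> SPD" and B: "B \<in> SPD"
  shows "\<exists>\<gamma>. geodesic_joining 0 1 \<gamma> A B"
proof -
  obtain T where T: "T \<in> SPD" "T ** A ** T = B" using transport_map_exists[OF A B] by blast
  define D where "D = T - mat 1"
  define M where "M t = mat 1 + t *\<^sub>R D" for t
  define \<gamma> where "\<gamma> t = M t ** A ** M t" for t
  define V where "V t = D ** A ** M t + M t ** A ** D" for t
  have D: "D \<in> Sym" unfolding D_def by (intro Sym_diff Sym_one SPD_Sym T)
  have M0: "M 0 = mat 1" and M1: "M 1 = T" by (simp_all add: M_def D_def)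
  have M: "M t \<in> SPD" if t: "t \<in> {0..1}" for t
  proof -
    consider "t = 0" | "t = 1" | "0 < t" "t < 1" using t by fastforce
    then show ?thesis
    proof cases
      case 3
      have "M t = (1 - t) *\<^sub>R mat 1 + t *\<^sub>R T"
        by (simp add: M_def D_def scaleR_diff_right scaleR_diff_left)
      then show ?thesis using 3 T by (simp add: SPD_add SPD_scaleR SPD_one)
    qed (use T in \<open>simp_all add: M0 M1 SPD_one\<close>)
  qed
  have \<gamma>: "\<gamma> t \<in> SPD" if "t \<in> {0..1}" for t
    unfolding \<gamma>_def using SPD_congruence[OF A SPD_Sym[OF M[OF that]]] SPD_inj[OF M[OF that]] by blast
  have dM: "(M has_vector_derivative D) (at t within S)" for t S
    unfolding M_def by (auto intro!: derivative_eq_intros)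
  have dAM: "((\<lambda>t. A ** M t) has_vector_derivative A ** D) (at t within S)"
    and dMA: "((\<lambda>t. M t ** A) has_vector_derivative D ** A) (at t within S)" for t S
    by (rule bounded_linear.has_vector_derivative[OF matrix_mul.bounded_linear_right dM]
        bounded_linear.has_vector_derivative[OF matrix_mul.bounded_linear_left dM])+
  have d\<gamma>: "(\<gamma> has_vector_derivative V t) (at t within S)" for t S
    unfolding \<gamma>_def V_def
    by (rule matrix_mul.has_vector_derivative[OF dMA dM, THEN has_vector_derivative_eq_rhs])
      (simp add: add.commute)
  have dV: "(V has_vector_derivative 2 *\<^sub>R (D ** A ** D)) (at t within S)" for t S
  proof -
    have "((\<lambda>t. D ** A ** M t + M t ** A ** D) has_vector_derivative (D ** A) ** D + (D ** A) ** D) (at t within S)"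
      by (intro has_vector_derivative_add
          bounded_linear.has_vector_derivative[OF matrix_mul.bounded_linear_right dM]
          bounded_linear.has_vector_derivative[OF matrix_mul.bounded_linear_left dMA])
    then show ?thesis unfolding V_def by (simp add: scaleR_2)
  qed
  have acc: "2 *\<^sub>R (D ** A ** D) + christoffel (\<gamma> t) (V t) (V t) = 0" if t: "t \<in> {0..1}" for t
  proof -
    obtain Q where Q: "M t ** Q = mat 1" "Q ** M t = mat 1" using SPD_inverse[OF M[OF t]] by blast
    \<comment> \<open>\<open>M t\<close> is a polynomial in \<open>D\<close>, so \<open>D\<close>
      commutes with it and with its inverse \<open>Q\<close>. The momentum is \<open>D ** Q\<close>,
      and in the acceleration all factors \<open>M t\<close> and \<open>Q\<close> cancel.\<close>
    have MD: "M t ** D = D ** M t" by (simp add: M_def matrix_ring_simps)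
    have QD: "Q ** D = D ** Q"
    proof -
      have "Q ** D = Q ** (D ** M t) ** Q" by (simp add: matrix_mul_assoc[symmetric] Q)
      also have "\<dots> = (Q ** M t) ** D ** Q" unfolding MD[symmetric] by (simp only: matrix_mul_assoc)
      finally show ?thesis by (simp add: Q)
    qed
    have l: "lyap (\<gamma> t) (V t) = D ** Q"
    proof (rule lyap_eqI[OF \<gamma>[OF t]])
      have "\<gamma> t ** (D ** Q) + (D ** Q) ** \<gamma> t = M t ** A ** ((M t ** D) ** Q) + D ** (Q ** M t) ** A ** M t"
        by (simp add: \<gamma>_def matrix_mul_assoc)
      also have "\<dots> = M t ** A ** (D ** (M t ** Q)) + D ** (Q ** M t) ** A ** M t"
        unfolding MD by (simp only: matrix_mul_assoc)
      finally show "\<gamma> t ** (D ** Q) + (D ** Q) ** \<gamma> t = V t" by (simp add: Q V_def add.commute)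
    qed
    have "V t \<in> Sym"
      using D SPD_Sym[OF A] SPD_Sym[OF M[OF t]]
      by (simp add: V_def Sym_def transpose_simps matrix_mul_assoc add.commute)
    then have "christoffel (\<gamma> t) (V t) (V t) = - (2 *\<^sub>R ((D ** Q) ** \<gamma> t ** (D ** Q)))"
      using christoffel_eq[OF \<gamma>[OF t]] by (simp add: l)
    also have "(D ** Q) ** \<gamma> t ** (D ** Q) = D ** (Q ** M t) ** A ** (M t ** (D ** Q))"
      by (simp add: \<gamma>_def matrix_mul_assoc)
    also have "\<dots> = D ** (Q ** M t) ** A ** ((M t ** Q) ** D)"
      unfolding QD[symmetric] by (simp only: matrix_mul_assoc)
    finally show ?thesis by (simp add: Q)
  qed
  have "geodesic_on {0..1} \<gamma>"
    unfolding geodesic_on_def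
    by (intro conjI exI[of _ V] exI[of _ "\<lambda>_. 2 *\<^sub>R (D ** A ** D)"] ballI d\<gamma> dV acc is_interval_cc)
      (use \<gamma> in auto)
  then have "geodesic_joining 0 1 \<gamma> A B"
    by (simp add: geodesic_joining_def \<gamma>_def M0 M1 T)
  then show ?thesis by blast
qed

text \<open>Nonsingularity of the points of \<open>\<gamma>\<close> passes to the factors
  \<open>mat 1 + r *\<^sub>R G\<close>, so the final factor is positive definite and must be
  \<open>T\<close>. Since the formula involves only \<open>A\<close>, \<open>T\<close> and
  normalized time, it yields uniqueness up to affine reparametrization.\<close>

lemma geodesic_joining_explicit:
  fixes A B T :: "real^'n^'n"
  assumes geo: "geodesic_joining a b \<gamma> A B" and T: "T \<in> SPD" "T ** A ** T = B" and t: "t \<in> {a..b}"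
  shows "\<gamma> t = (mat 1 + ((t - a) / (b - a)) *\<^sub>R (T - mat 1)) ** A ** (mat 1 + ((t - a) / (b - a)) *\<^sub>R (T - mat 1))"
proof -
  have "a < b" and geo': "geodesic_on {a..b} \<gamma>" and ends: "\<gamma> a = A" "\<gamma> b = B"
    using geo by (auto simp: geodesic_joining_def)
  have SPD: "\<gamma> s \<in> SPD" if "s \<in> {a..b}" for s using geo' that by (auto simp: geodesic_on_def)
  have A: "A \<in> SPD" using SPD[of a] ends \<open>a < b\<close> by simp
  obtain G where G: "G \<in> Sym"
    and \<gamma>: "\<And>t. t \<in> {a..b} \<Longrightarrow> \<gamma> t = (mat 1 + (t - a) *\<^sub>R G) ** A ** (mat 1 + (t - a) *\<^sub>R G)"
    using geodesic_explicit[OF geo' \<open>a < b\<close>] unfolding ends by metis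
  have "mat 1 + (b - a) *\<^sub>R G \<in> SPD"
  proof (rule nonsingular_segment_SPD[OF G])
    fix r x assume r: "0 \<le> r" "r \<le> b - a" and "(mat 1 + r *\<^sub>R G) *v x = 0"
    then have "\<gamma> (a + r) *v x = 0" using \<gamma>[of "a + r"] by (simp flip: matrix_vector_mul_assoc)
    then show "x = 0" using SPD_inj[OF SPD[of "a + r"]] r by simp
  qed (use \<open>a < b\<close> in simp)
  then have "mat 1 + (b - a) *\<^sub>R G = T"
    using transport_map_unique[OF A _ T(1)] T(2) \<gamma>[of b] ends \<open>a < b\<close> by simp
  then have "T - mat 1 = (b - a) *\<^sub>R G" by auto
  then have "((t - a) / (b - a)) *\<^sub>R (T - mat 1) = (t - a) *\<^sub>R G" using \<open>a < b\<close> by simp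
  then show ?thesis using \<gamma>[OF t] by simp
qed

lemma geodesic_joining_unique:
  fixes A B :: "real^'n^'n"
  assumes A: "A \<in> SPD" and B: "B \<in> SPD"
    and geo: "geodesic_joining a b \<gamma> A B" "geodesic_joining c d \<sigma> A B" and t: "t \<in> {c..d}"
  shows "\<sigma> t = \<gamma> (a + (b - a) * ((t - c) / (d - c)))"
proof -
  obtain T where T: "T \<in> SPD" "T ** A ** T = B" using transport_map_exists[OF A B] by blast
  have ab: "a < b" "c < d" using geo by (auto simp: geodesic_joining_def)
  define r where "r = (t - c) / (d - c)"
  have r: "0 \<le> r" "r \<le> 1" using t ab by (auto simp: r_def)
  have "(b - a) * r \<le> b - a" using r ab mult_left_mono[of r 1 "b - a"] by simp
  moreover have "0 \<le> (b - a) * r" using r ab by simp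
  ultimately have "a + (b - a) * r \<in> {a..b}" by simp
  from geodesic_joining_explicit[OF geo(1) T this] geodesic_joining_explicit[OF geo(2) T t]
  show ?thesis using ab by (simp add: r_def[symmetric])
qed

section \<open>Regularity and speed of piecewise C1 curves\<close>

text \<open>Induction on the break points: an interval with the new point in its interior is cut
  there and rejoined. \<open>P\<close> will be continuity and integrability on the interval.\<close>

lemma finite_subdivision_induct:
  fixes p q :: real
  assumes "finite S"
    and base: "\<And>p q. u \<le> p \<Longrightarrow> p < q \<Longrightarrow> q \<le> v \<Longrightarrow> {p<..<q} \<inter> S = {} \<Longrightarrow> P p q"
    and join: "\<And>p x q. u \<le> p \<Longrightarrow> p < x \<Longrightarrow> x < q \<Longrightarrow> q \<le> v \<Longrightarrow> P p x \<Longrightarrow> P x q \<Longrightarrow> P p q"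
    and "u \<le> p" "p < q" "q \<le> v"
  shows "P p q"
  using assms(1,2,4-)
proof (induction S arbitrary: p q)
  case empty
  then show ?case by blast
next
  case (insert x S)
  have "P p q" if pq: "u \<le> p" "p < q" "q \<le> v" "{p<..<q} \<inter> S = {}" for p q
  proof (cases "x \<in> {p<..<q}")
    case True
    moreover from True have "{p<..<x} \<subseteq> {p<..<q} - {x}" "{x<..<q} \<subseteq> {p<..<q} - {x}" by auto
    then have "{p<..<x} \<inter> insert x S = {}" "{x<..<q} \<inter> insert x S = {}"
      using pq(4) by blast+
    ultimately have "P p x" "P x q" using pq by (auto intro!: insert.prems(1))
    then show ?thesis using join[of p x q] True pq by simp
  next
    case False
    then show ?thesis using pq by (intro insert.prems(1)) auto
  qed
  then show ?case using insert.IH insert.prems(2-) by blast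
qed

lemma continuous_on_gW:
  fixes c V :: "real \<Rightarrow> real^'n^'n"
  assumes c: "continuous_on I c" "c ` I \<subseteq> SPD" and V: "continuous_on I V"
  shows "continuous_on I (\<lambda>s. gW (c s) (V s) (V s))"
proof -
  have lyap: "continuous_on I (\<lambda>s. lyap (c s) (V s))"
    unfolding continuous_on_def
  proof
    fix t assume "t \<in> I"
    have "\<forall>\<^sub>F s in at t within I. c s \<in> SPD"
      unfolding eventually_at_filter using c(2) by (intro always_eventually) blast
    then show "((\<lambda>s. lyap (c s) (V s)) \<longlongrightarrow> lyap (c t) (V t)) (at t within I)"
      using c V \<open>t \<in> I\<close> by (intro tendsto_lyap) (auto simp: continuous_on_def)
  qed
  show ?thesis
    unfolding gW_def trace_matrix_mul_eq_inner
    by (intro continuous_on_inner matrix_mul.continuous_on lyap c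
        bounded_linear.continuous_on[OF bounded_linear_transpose])
qed

text \<open>Supplies the regularity for the calibration argument. Each piece has its own velocity,
  but in its interior this is the two-sided derivative and hence agrees with the one used in
  \<open>len\<close>. The values of \<open>\<sigma>\<close> at the finitely many break points stay
  uncontrolled.\<close>

lemma pw_C1_curve_speed:
  fixes c :: "real \<Rightarrow> real^'n^'n"
  assumes c: "pw_C1_curve u v c" and uv: "u < v"
  defines "\<sigma> \<equiv> \<lambda>t. let w = vector_derivative c (at t within {u..v}) in sqrt (gW (c t) w w)"
  obtains S V where "finite S" "continuous_on {u..v} c" "\<sigma> integrable_on {u..v}"
    "\<And>t. t \<in> {u<..<v} - S \<Longrightarrow> (c has_vector_derivative V t) (at t)"
    "\<And>t. t \<in> {u<..<v} - S \<Longrightarrow> V t \<in> Sym"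
    "\<And>t. t \<in> {u<..<v} - S \<Longrightarrow> \<sigma> t = sqrt (gW (c t) (V t) (V t))"
    "\<And>t. t \<in> {u<..<v} - S \<Longrightarrow> isCont \<sigma> t"
proof -
  have SPD: "c ` {u..v} \<subseteq> SPD" using c by (simp add: pw_C1_curve_def)
  from c have "\<exists>S. finite S \<and> (\<forall>p q. u \<le> p \<and> p < q \<and> q \<le> v \<and> {p<..<q} \<inter> S = {} \<longrightarrow>
      (\<exists>V. continuous_on {p..q} V \<and> (\<forall>t\<in>{p..q}. (c has_vector_derivative V t) (at t within {p..q}))))"
    unfolding pw_C1_curve_def by (elim conjE)
  then obtain S where S: "finite S" and
    pieces: "\<forall>p q. u \<le> p \<and> p < q \<and> q \<le> v \<and> {p<..<q} \<inter> S = {} \<longrightarrow>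
      (\<exists>V. continuous_on {p..q} V \<and> (\<forall>t\<in>{p..q}. (c has_vector_derivative V t) (at t within {p..q})))"
    by (elim exE conjE) (rule that)
  note piece = pieces[rule_format, OF conjI, OF _ conjI, OF _ _ conjI]
  have at: "at t within {p..q} = at t" if "p < t" "t < q" for p q t :: real
    using that by (intro at_within_interior) simp
  have piece': "\<exists>V. continuous_on {p..q} c \<and> continuous_on {p..q} (\<lambda>t. sqrt (gW (c t) (V t) (V t))) \<and>
      (\<forall>t\<in>{p<..<q}. (c has_vector_derivative V t) (at t) \<and> V t \<in> Sym \<and> \<sigma> t = sqrt (gW (c t) (V t) (V t)))"
    if pq: "u \<le> p" "p < q" "q \<le> v" "{p<..<q} \<inter> S = {}" for p q
  proof -
    obtain V where V: "continuous_on {p..q} V" "\<And>t. t \<in> {p..q} \<Longrightarrow> (c has_vector_derivative V t) (at t within {p..q})"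
      using piece[OF pq] by blast
    have sub: "c ` {p..q} \<subseteq> SPD" using SPD pq by auto
    have cc: "continuous_on {p..q} c"
      unfolding continuous_on_eq_continuous_within
      using V(2) has_vector_derivative_continuous by blast
    have "continuous_on {p..q} (\<lambda>t. sqrt (gW (c t) (V t) (V t)))"
      by (intro continuous_on_real_sqrt continuous_on_gW cc sub V(1))
    moreover have "(c has_vector_derivative V t) (at t) \<and> V t \<in> Sym \<and> \<sigma> t = sqrt (gW (c t) (V t) (V t))"
      if t: "t \<in> {p<..<q}" for t
    proof (intro conjI)
      show d: "(c has_vector_derivative V t) (at t)" using V(2)[of t] t at[of p t q] by simp
      show "V t \<in> Sym"
        using has_vector_derivative_Sym[OF pq(2), of c t "V t"] sub SPD_Sym t V(2)[of t] by auto
      have "vector_derivative c (at t within {u..v}) = V t"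
        using vector_derivative_at[OF d] at[of u t v] t pq by simp
      then show "\<sigma> t = sqrt (gW (c t) (V t) (V t))" by (simp only: \<sigma>_def Let_def)
    qed
    ultimately show ?thesis using cc by blast
  qed
  have "continuous_on {u..v} c"
  proof (rule finite_subdivision_induct[OF S, where u = u and v = v])
    fix p x q :: real assume "p < x" "x < q" and "continuous_on {p..x} c" "continuous_on {x..q} c"
    then have "continuous_on ({p..x} \<union> {x..q}) c" by (intro continuous_on_closed_Un) auto
    moreover have "{p..x} \<union> {x..q} = {p..q}" using \<open>p < x\<close> \<open>x < q\<close> by auto
    ultimately show "continuous_on {p..q} c" by simp
  qed (use piece' uv in auto)
  moreover have "\<sigma> integrable_on {u..v}"
  proof (rule finite_subdivision_induct[OF S, where u = u and v = v])
    fix p x q :: real assume "p < x" "x < q" and "\<sigma> integrable_on {p..x}" "\<sigma> integrable_on {x..q}"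
    then show "\<sigma> integrable_on {p..q}" by (intro Henstock_Kurzweil_Integration.integrable_combine[where a = p and b = q and c = x]) auto
  next
    fix p q assume pq: "u \<le> p" "p < q" "q \<le> v" "{p<..<q} \<inter> S = {}"
    obtain V where V: "continuous_on {p..q} (\<lambda>t. sqrt (gW (c t) (V t) (V t)))"
      "\<And>t. t \<in> {p<..<q} \<Longrightarrow> \<sigma> t = sqrt (gW (c t) (V t) (V t))"
      using piece'[OF pq] by blast
    \<comment> \<open>Inside the piece \<open>\<sigma>\<close> equals a continuous function, and the
      two endpoints do not affect integrability.\<close>
    show "\<sigma> integrable_on {p..q}"
      using integrable_spike_interior[where f = "\<lambda>t. sqrt (gW (c t) (V t) (V t))" and a = p and b = q and g = \<sigma>]
        integrable_continuous_interval[OF V(1)] V(2) by simp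
  qed (use uv in auto)
  moreover have "\<exists>V. (c has_vector_derivative V) (at t) \<and> V \<in> Sym \<and> \<sigma> t = sqrt (gW (c t) V V) \<and> isCont \<sigma> t"
    if t: "t \<in> {u<..<v} - S" for t
  proof -
    \<comment> \<open>A small closed interval around \<open>t\<close> that avoids the break points
      is itself a C1 piece.\<close>
    have "open ({u<..<v} - S)" using S by (simp add: open_Diff finite_imp_closed)
    then obtain e where e: "e > 0" "cball t e \<subseteq> {u<..<v} - S"
      using t open_contains_cball by blast
    define p where "p = t - e"
    define q where "q = t + e"
    have cb: "{p..q} \<subseteq> {u<..<v} - S" using e(2) by (simp add: p_def q_def cball_eq_atLeastAtMost)
    have pt: "p < t" "t < q" using e(1) by (auto simp: p_def q_def)
    have "p \<in> {p..q}" "q \<in> {p..q}" using pt by auto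
    then have "p \<in> {u<..<v} - S" "q \<in> {u<..<v} - S" using cb by blast+
    then have pq: "u \<le> p" "p < q" "q \<le> v" using pt by auto
    have "{p<..<q} \<subseteq> {p..q}" by auto
    then have "{p<..<q} \<inter> S = {}" using cb by blast
    then obtain V where V: "continuous_on {p..q} (\<lambda>t. sqrt (gW (c t) (V t) (V t)))"
      "\<And>t. t \<in> {p<..<q} \<Longrightarrow> (c has_vector_derivative V t) (at t) \<and> V t \<in> Sym \<and> \<sigma> t = sqrt (gW (c t) (V t) (V t))"
      using piece'[OF pq] by blast
    have "continuous_on {p<..<q} \<sigma> \<longleftrightarrow> continuous_on {p<..<q} (\<lambda>t. sqrt (gW (c t) (V t) (V t)))"
      by (intro continuous_on_cong refl) (use V(2) in blast)
    then have "continuous_on {p<..<q} \<sigma>"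
      using continuous_on_subset[OF V(1) \<open>{p<..<q} \<subseteq> {p..q}\<close>] by blast
    then have "isCont \<sigma> t" using pt by (simp add: continuous_on_eq_continuous_at)
    then show ?thesis using V(2)[of t] pt by auto
  qed
  then obtain V where "\<And>t. t \<in> {u<..<v} - S \<Longrightarrow>
    (c has_vector_derivative V t) (at t) \<and> V t \<in> Sym \<and> \<sigma> t = sqrt (gW (c t) (V t) (V t)) \<and> isCont \<sigma> t"
    by metis
  ultimately show ?thesis using that[OF S, of V] by blast
qed

subsection \<open>Minimality\<close>

lemma SPD_inner_nonneg:
  fixes A :: "real^'n^'n"
  assumes "A \<in> SPD"
  shows "0 \<le> X \<bullet> (A ** X)"
proof -
  obtain m where m: "m > 0" "\<And>x. m * (norm x)\<^sup>2 \<le> x \<bullet> (A *v x)"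
    using SPD_coercive[OF assms] by blast
  have "0 \<le> m * (norm X)\<^sup>2" using m(1) by simp
  also have "\<dots> \<le> X \<bullet> (A ** X)" by (rule coercive_matrix_mul_left[OF SPD_Sym[OF assms] m(2)])
  finally show ?thesis .
qed

text \<open>Along a curve with velocity \<open>V\<close>, the left-hand side is \<open>r\<close> times the derivative of \<open>G \<bullet> A\<close>
  when \<open>G\<close> evolves by the geodesic equation \<open>G' = - G\<^sup>2\<close> at speed \<open>r\<close>.\<close>

lemma calibration_inequality:
  fixes A G V :: "real^'n^'n"
  assumes A: "A \<in> SPD" and V: "V \<in> Sym" and G: "G \<in> Sym"
  shows "r * (- (r * ((G ** G) \<bullet> A)) + G \<bullet> V) \<le> gW A V V"
proof -
  let ?H = "lyap A V"
  \<comment> \<open>Completing the square: the claim is nonnegativity of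
    \<open>D \<bullet> (A ** D)\<close>, with equality when \<open>r *\<^sub>R G\<close> is the
    momentum of \<open>V\<close>.\<close>
  define D where "D = r *\<^sub>R G - ?H"
  have H: "?H \<in> Sym" using lyap_Sym A V by blast
  note sym = Sym_transpose[OF G] Sym_transpose[OF SPD_Sym[OF A]] Sym_transpose[OF H]
  have comm: "X \<bullet> (Y ** A) = X \<bullet> (A ** Y)" if "X \<in> Sym" "Y \<in> Sym" for X Y
    using inner_transpose[of X "Y ** A"] that inner_matrix_mul_left[of A Y X] inner_matrix_mul_right[of Y A X]
    by (metis Sym_transpose inner_commute matrix_transpose_mul SPD_Sym[OF A])
  have GG: "(G ** G) \<bullet> A = G \<bullet> (A ** G)"
    using inner_matrix_mul_right[of G G A] by (simp add: sym)
  have "G \<bullet> V = G \<bullet> (A ** ?H + ?H ** A)" using lyap_eq[OF A] by simp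
  then have GV: "G \<bullet> V = 2 * (G \<bullet> (A ** ?H))"
    using comm[OF G H] by (simp add: inner_add_right)
  have HG: "?H \<bullet> (A ** G) = G \<bullet> (A ** ?H)"
    using inner_matrix_mul_left[of A G ?H] by (simp add: sym inner_commute)
  have "0 \<le> D \<bullet> (A ** D)" by (rule SPD_inner_nonneg[OF A])
  also have "\<dots> = r * r * (G \<bullet> (A ** G)) - r * (2 * (G \<bullet> (A ** ?H))) + ?H \<bullet> (A ** ?H)"
    unfolding D_def
    by (simp add: matrix_mul.diff_right matrix_mul.scaleR_right inner_diff_left inner_diff_right HG algebra_simps)
  finally show ?thesis unfolding gW_self[OF A V] GG GV by (simp add: algebra_simps)
qed

text \<open>On the geodesic itself the calibration is exact: the squared speed is the constant
  \<open>k = trace K\<close>, and \<open>G t \<bullet> \<gamma> t\<close> grows at that same rate,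
  because the product rule gives \<open>2 * k - k\<close>.\<close>

lemma geodesic_length:
  fixes \<gamma> :: "real \<Rightarrow> real^'n^'n"
  assumes geo: "geodesic_on {a..b} \<gamma>" and "a < b"
  obtains G where "\<And>t. t \<in> {a..b} \<Longrightarrow> G t \<in> Sym"
    and "\<And>t. t \<in> {a..b} \<Longrightarrow> (G has_vector_derivative - (G t ** G t)) (at t within {a..b})"
    and "G b \<bullet> \<gamma> b - G a \<bullet> \<gamma> a = (len a b \<gamma>)\<^sup>2 / (b - a)" and "0 \<le> len a b \<gamma>"
proof -
  obtain G K where G: "\<And>t. t \<in> {a..b} \<Longrightarrow> G t \<in> Sym"
    and d\<gamma>: "\<And>t. t \<in> {a..b} \<Longrightarrow> (\<gamma> has_vector_derivative \<gamma> t ** G t + G t ** \<gamma> t) (at t within {a..b})"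
    and dG: "\<And>t. t \<in> {a..b} \<Longrightarrow> (G has_vector_derivative - (G t ** G t)) (at t within {a..b})"
    and K: "\<And>t. t \<in> {a..b} \<Longrightarrow> G t ** \<gamma> t ** G t = K"
    using geodesic_lyap_ODE[OF assms] by metis
  define k where "k = trace K"
  have SPD: "\<gamma> t \<in> SPD" if "t \<in> {a..b}" for t using geo that by (auto simp: geodesic_on_def)
  have k: "G t \<bullet> (\<gamma> t ** G t) = k" if "t \<in> {a..b}" for t
    using trace_matrix_mul_eq_inner[of "G t" "\<gamma> t ** G t"] K[OF that] Sym_transpose[OF G[OF that]]
    by (simp add: k_def matrix_mul_assoc)
  have k0: "0 \<le> k" using k[of a] SPD_inner_nonneg[OF SPD[of a], of "G a"] \<open>a < b\<close> by simp
  have speed: "(let v = vector_derivative \<gamma> (at t within {a..b}) in sqrt (gW (\<gamma> t) v v)) = sqrt k"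
    if t: "t \<in> {a..b}" for t
  proof -
    let ?v = "\<gamma> t ** G t + G t ** \<gamma> t"
    have v: "vector_derivative \<gamma> (at t within {a..b}) = ?v"
      using vector_derivative_within_cbox[OF \<open>a < b\<close> _ d\<gamma>[OF t, folded cbox_interval]] t by simp
    have "lyap (\<gamma> t) ?v = G t" by (rule lyap_eqI[OF SPD[OF t]]) simp
    moreover have "?v \<in> Sym" by (rule Sym_anticommutator[OF SPD_Sym[OF SPD[OF t]] G[OF t]])
    ultimately show ?thesis unfolding v Let_def using gW_self[OF SPD[OF t], of ?v] k[OF t] by simp
  qed
  have "len a b \<gamma> = integral {a..b} (\<lambda>t. sqrt k)"
    unfolding len_def by (rule integral_cong) (rule speed)
  then have len: "len a b \<gamma> = (b - a) * sqrt k" using \<open>a < b\<close> by simp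
  have "((\<lambda>t. G t \<bullet> \<gamma> t - t * k) has_vector_derivative 0) (at t within {a..b})" if t: "t \<in> {a..b}" for t
  proof -
    have sym: "transpose (G t) = G t" using Sym_transpose G t by blast
    have tr: "transpose (\<gamma> t) = \<gamma> t" using Sym_transpose SPD_Sym SPD t by blast
    have "G t \<bullet> (G t ** \<gamma> t) = k"
      using inner_transpose[of "G t" "\<gamma> t ** G t"] by (simp add: sym tr matrix_transpose_mul k[OF t])
    moreover have "(G t ** G t) \<bullet> \<gamma> t = k"
      using inner_matrix_mul_right[of "G t" "G t" "\<gamma> t"] by (simp add: sym k[OF t])
    ultimately have "G t \<bullet> (\<gamma> t ** G t + G t ** \<gamma> t) + (- (G t ** G t)) \<bullet> \<gamma> t - k = 0"
      by (simp add: inner_add_right k[OF t])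
    moreover have "((\<lambda>t. G t \<bullet> \<gamma> t - t * k) has_vector_derivative
        G t \<bullet> (\<gamma> t ** G t + G t ** \<gamma> t) + (- (G t ** G t)) \<bullet> \<gamma> t - k) (at t within {a..b})"
      by (intro has_vector_derivative_diff bounded_bilinear.has_vector_derivative[OF bounded_bilinear_inner] dG d\<gamma> t)
        (auto intro!: derivative_eq_intros simp: has_real_derivative_iff_has_vector_derivative[symmetric])
    ultimately show ?thesis by simp
  qed
  from has_vector_derivative_zero_constant[OF this, of b a] \<open>a < b\<close>
  have "G b \<bullet> \<gamma> b - G a \<bullet> \<gamma> a = (b - a) * k" by (simp add: algebra_simps)
  moreover have "(len a b \<gamma>)\<^sup>2 / (b - a) = (b - a) * k"
    using k0 \<open>a < b\<close> by (simp add: len power_mult_distrib power2_eq_square)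
  ultimately show ?thesis
    using that[OF G dG] k0 \<open>a < b\<close> by (simp add: len)
qed

text \<open>The calibration argument needs \<open>c\<close> to run through the time interval of \<open>\<gamma>\<close> with constant
  speed. Since the speed \<open>\<sigma>\<close> of \<open>c\<close> may vanish, \<open>\<theta>\<close> is the rescaled integral of \<open>\<sigma> + \<epsilon>\<close>.\<close>

lemma geodesic_len_le:
  fixes \<gamma> c :: "real \<Rightarrow> real^'n^'n"
  assumes geo: "geodesic_on {a..b} \<gamma>" and ab: "a < b"
    and c: "pw_C1_curve u v c" and uv: "u < v" and ends: "c u = \<gamma> a" "c v = \<gamma> b"
  shows "len a b \<gamma> \<le> len u v c"
proof -
  obtain G where G: "\<And>t. t \<in> {a..b} \<Longrightarrow> G t \<in> Sym"
    and dG: "\<And>t. t \<in> {a..b} \<Longrightarrow> (G has_vector_derivative - (G t ** G t)) (at t within {a..b})"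
    and drop: "G b \<bullet> \<gamma> b - G a \<bullet> \<gamma> a = (len a b \<gamma>)\<^sup>2 / (b - a)" and len0: "0 \<le> len a b \<gamma>"
    using geodesic_length[OF geo ab] by metis
  define \<sigma> where "\<sigma> t = (let w = vector_derivative c (at t within {u..v}) in sqrt (gW (c t) w w))" for t
  obtain S V where S: "finite S" and cc: "continuous_on {u..v} c" and int: "\<sigma> integrable_on {u..v}"
    and V: "\<And>t. t \<in> {u<..<v} - S \<Longrightarrow> (c has_vector_derivative V t) (at t)"
    and Vs: "\<And>t. t \<in> {u<..<v} - S \<Longrightarrow> V t \<in> Sym"
    and \<sigma>V: "\<And>t. t \<in> {u<..<v} - S \<Longrightarrow> \<sigma> t = sqrt (gW (c t) (V t) (V t))"
    and \<sigma>C: "\<And>t. t \<in> {u<..<v} - S \<Longrightarrow> isCont \<sigma> t"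
    using pw_C1_curve_speed[OF c uv, folded \<sigma>_def] by metis
  have SPD: "c t \<in> SPD" if "t \<in> {u..v}" for t using c that by (auto simp: pw_C1_curve_def)

  have \<sigma>0: "0 \<le> \<sigma> t" if "t \<in> {u<..<v} - S" for t
  proof -
    have t: "t \<in> {u..v}" using that by auto
    show ?thesis
      using SPD_inner_nonneg[OF SPD[OF t]] gW_self[OF SPD[OF t] Vs[OF that]] \<sigma>V[OF that] by simp
  qed
  define L where "L = integral {u..v} \<sigma>"
  have L: "L = len u v c" unfolding L_def len_def \<sigma>_def ..
  \<comment> \<open>Same integral as \<open>\<sigma>\<close>, but nonnegative also at break points
    and endpoints.\<close>
  define \<tau> where "\<tau> t = (if t \<in> {u<..<v} - S then \<sigma> t else 0)" for t
  have \<tau>0: "0 \<le> \<tau> t" for t using \<sigma>0 by (simp add: \<tau>_def)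
  have \<tau>: "(\<tau> has_integral L) {u..v}"
  proof (rule has_integral_spike_finite[of "S \<union> {u, v}" _ _ \<sigma>])
    show "(\<sigma> has_integral L) {u..v}" unfolding L_def using int by (rule integrable_integral)
  qed (use S in \<open>auto simp: \<tau>_def\<close>)
  have L0: "0 \<le> L" using has_integral_nonneg[OF \<tau>] \<tau>0 by blast
  have main: "(len a b \<gamma>)\<^sup>2 \<le> L * (L + \<epsilon> * (v - u))" if \<epsilon>: "\<epsilon> > 0" for \<epsilon>
  proof -
    define \<Lambda> where "\<Lambda> = L + \<epsilon> * (v - u)"
    have \<Lambda>: "\<Lambda> > 0" using L0 \<epsilon> uv by (simp add: \<Lambda>_def add_nonneg_pos)
    \<comment> \<open>Since \<open>f\<close> below has total integral \<open>\<Lambda>\<close>, this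
      factor makes \<open>\<theta>\<close> run from \<open>a\<close> to \<open>b\<close>.\<close>
    define k where "k = (b - a) / \<Lambda>"
    have k: "k > 0" using ab \<Lambda> by (simp add: k_def)
    define f where "f t = \<tau> t + \<epsilon>" for t
    have f: "(f has_integral \<Lambda>) {u..v}"
      unfolding f_def \<Lambda>_def using has_integral_add[OF \<tau> has_integral_const_real[of \<epsilon> u v]] uv by (simp add: mult.commute)
    have f_int: "f integrable_on {p..q}" if "u \<le> p" "q \<le> v" for p q
      using integrable_on_subinterval[of f "{u..v}" p q] f that by (auto simp: integrable_on_def)
    have f0: "0 \<le> f t" for t using \<tau>0[of t] \<epsilon> by (simp add: f_def)
    define \<theta> where "\<theta> s = a + k * integral {u..s} f" for s
    have \<theta>u: "\<theta> u = a" by (simp add: \<theta>_def)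
    have \<theta>v: "\<theta> v = b" using integral_unique[OF f] \<Lambda> by (simp add: \<theta>_def k_def)
    have \<theta>: "\<theta> s \<in> {a..b}" if s: "s \<in> {u..v}" for s
    proof -
      have "0 \<le> integral {u..s} f" using f0 by (intro integral_nonneg f_int) (use s in auto)
      moreover have "integral {u..s} f + integral {s..v} f = integral {u..v} f"
        using s f_int by (intro Henstock_Kurzweil_Integration.integral_combine) auto
      moreover have "0 \<le> integral {s..v} f" using f0 by (intro integral_nonneg f_int) (use s in auto)
      ultimately have "\<theta> u \<le> \<theta> s" "\<theta> s \<le> \<theta> v" using k by (auto simp: \<theta>_def)
      then show ?thesis by (simp add: \<theta>u \<theta>v)
    qed
    have \<theta>C: "continuous_on {u..v} \<theta>"
      unfolding \<theta>_def by (intro continuous_intros indefinite_integral_continuous_1 f_int) auto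
    have d\<theta>: "(\<theta> has_vector_derivative k * (\<sigma> s + \<epsilon>)) (at s)" if s: "s \<in> {u<..<v} - S" for s
    proof -
      have open_good: "open ({u<..<v} - S)" using S by (simp add: open_Diff finite_imp_closed)
      have ev: "\<forall>\<^sub>F t in nhds s. f t = \<sigma> t + \<epsilon>"
        using eventually_nhds_in_open[OF open_good s] by eventually_elim (simp add: f_def \<tau>_def)
      have "isCont (\<lambda>t. \<sigma> t + \<epsilon>) s" using \<sigma>C[OF s] by (intro continuous_intros)
      then have "isCont f s" using isCont_cong[OF ev] by simp
      then have "((\<lambda>x. integral {u..x} f) has_vector_derivative f s) (at s within {u..v})"
        using integral_has_vector_derivative_continuous_at[of f u v s "{}"] f_int[of u v] s
        by (simp add: continuous_at_imp_continuous_at_within)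
      moreover have "at s within {u..v} = at s" using s by (intro at_within_interior) simp
      moreover have "f s = \<sigma> s + \<epsilon>" using s by (simp add: f_def \<tau>_def)
      ultimately have "((\<lambda>x. integral {u..x} f) has_real_derivative \<sigma> s + \<epsilon>) (at s)"
        by (simp add: has_real_derivative_iff_has_vector_derivative)
      then show ?thesis
        unfolding \<theta>_def has_real_derivative_iff_has_vector_derivative[symmetric]
        by (auto intro!: derivative_eq_intros)
    qed
    define F where "F s = G (\<theta> s) \<bullet> c s" for s
    define r where "r s = k * (\<sigma> s + \<epsilon>)" for s
    \<comment> \<open>The fundamental theorem tolerates a finite exceptional set; the default 0
      keeps the pointwise bound \<open>le\<close> true there.\<close>
    define F' where "F' s = (if s \<in> {u<..<v} - S
      then - (r s * ((G (\<theta> s) ** G (\<theta> s)) \<bullet> c s)) + G (\<theta> s) \<bullet> V s else 0)" for s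
    have FC: "continuous_on {u..v} F"
    proof -
      have "continuous_on {a..b} G"
        unfolding continuous_on_eq_continuous_within using dG has_vector_derivative_continuous by blast
      then have "continuous_on {u..v} (\<lambda>s. G (\<theta> s))"
        using continuous_on_compose2[of "{a..b}" G "{u..v}" \<theta>] \<theta>C \<theta> by blast
      then show ?thesis unfolding F_def using cc by (intro continuous_on_inner)
    qed
    have dF: "(F has_vector_derivative F' s) (at s)" if s: "s \<in> {u<..<v} - S" for s
    proof -
      have at: "at s within {u..v} = at s" using s by (intro at_within_interior) simp
      \<comment> \<open>The chain rule is applied within intervals because \<open>G\<close> is
        differentiable only relative to \<open>{a..b}\<close>.\<close>
      have "((G \<circ> \<theta>) has_vector_derivative r s *\<^sub>R (- (G (\<theta> s) ** G (\<theta> s)))) (at s within {u..v})"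
      proof (rule vector_diff_chain_within)
        show "(\<theta> has_vector_derivative r s) (at s within {u..v})" using d\<theta>[OF s] by (simp add: r_def at)
        have "\<theta> s \<in> {a..b}" using \<theta> s by simp
        from has_vector_derivative_within_subset[OF dG[OF this]]
        show "(G has_vector_derivative - (G (\<theta> s) ** G (\<theta> s))) (at (\<theta> s) within \<theta> ` {u..v})"
          using \<theta> by blast
      qed
      then have "((\<lambda>s. G (\<theta> s)) has_vector_derivative r s *\<^sub>R (- (G (\<theta> s) ** G (\<theta> s)))) (at s)"
        by (simp add: at o_def)
      from bounded_bilinear.has_vector_derivative[OF bounded_bilinear_inner this V[OF s]]
      show ?thesis using s by (simp add: F_def[abs_def] F'_def add.commute)
    qed
    have F_int: "(F' has_integral (F v - F u)) {u..v}"
      by (rule fundamental_theorem_of_calculus_interior_strong[OF S _ dF FC]) (use uv in auto)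
    have le: "F' s \<le> \<Lambda> / (b - a) * \<tau> s" for s
    proof (cases "s \<in> {u<..<v} - S")
      case True
      have sg: "0 \<le> \<sigma> s" using \<sigma>0 True by blast
      have r: "r s > 0" using k \<epsilon> sg by (simp add: r_def)
      have "r s * F' s \<le> gW (c s) (V s) (V s)"
        using calibration_inequality[OF SPD Vs G, of s s "\<theta> s"] True \<theta> by (simp add: F'_def)
      also have "gW (c s) (V s) (V s) = (\<sigma> s)\<^sup>2" using \<sigma>V[OF True] sg by simp
      \<comment> \<open>Enlarging one factor by \<open>\<epsilon>\<close> produces the factor
        \<open>r s\<close>, which is positive even where the speed vanishes and can be
        cancelled.\<close>
      also have "\<dots> \<le> \<sigma> s * (\<sigma> s + \<epsilon>)" using sg \<epsilon> by (simp add: power2_eq_square mult_left_mono)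
      also have "\<dots> = r s * (\<Lambda> / (b - a) * \<sigma> s)" using ab \<Lambda> by (simp add: r_def k_def)
      finally have "F' s \<le> \<Lambda> / (b - a) * \<sigma> s" by (rule mult_left_le_imp_le[OF _ r])
      then show ?thesis using True by (simp add: \<tau>_def)
    qed (auto simp: F'_def \<tau>_def)
    have "F v - F u \<le> \<Lambda> / (b - a) * L"
      by (rule has_integral_le[OF F_int has_integral_mult_right[OF \<tau>]]) (rule le)
    moreover have "F v - F u = (len a b \<gamma>)\<^sup>2 / (b - a)"
      using drop ends by (simp add: F_def \<theta>u \<theta>v)
    ultimately have "(len a b \<gamma>)\<^sup>2 / (b - a) \<le> (L * \<Lambda>) / (b - a)" by (simp add: mult.commute)
    then show ?thesis using ab by (simp add: \<Lambda>_def divide_le_cancel)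
  qed
  have "(len a b \<gamma>)\<^sup>2 \<le> L\<^sup>2"
  proof (rule field_le_epsilon)
    fix e :: real assume e: "e > 0"
    \<comment> \<open>With \<open>\<epsilon> = e / d\<close> the excess in \<open>main\<close> is at
      most \<open>e\<close>; the summand 1 keeps \<open>d\<close> positive when
      \<open>L = 0\<close>.\<close>
    define d where "d = L * (v - u) + 1"
    have d: "d > 0" using L0 uv by (simp add: d_def add_nonneg_pos)
    have "L * (L + e / d * (v - u)) = L\<^sup>2 + e * ((L * (v - u)) / d)" by (simp add: power2_eq_square algebra_simps)
    also have "\<dots> \<le> L\<^sup>2 + e * 1" using d e by (intro add_left_mono mult_left_mono) (auto simp: d_def)
    finally show "(len a b \<gamma>)\<^sup>2 \<le> L\<^sup>2 + e" using main[of "e / d"] e d by simp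
  qed
  then show ?thesis unfolding L[symmetric] using L0 by (rule power2_le_imp_le)
qed

lemma pw_C1_curve_const: "A \<in> SPD \<Longrightarrow> u \<le> v \<Longrightarrow> pw_C1_curve u v (\<lambda>_. A)"
  unfolding pw_C1_curve_def by (auto intro!: exI[of _ "{}"] exI[of _ "\<lambda>_. 0"] continuous_intros)

lemma len_const:
  assumes "A \<in> SPD" "u < v"
  shows "len u v (\<lambda>_. A) = 0"
proof -
  have "vector_derivative (\<lambda>_. A) (at t within {u..v}) = 0" if "t \<in> {u..v}" for t
    using that vector_derivative_within_cbox[of u v t "\<lambda>_. A" 0] assms(2) by simp
  moreover have "gW A 0 0 = 0"
  proof -
    have "lyap A 0 = 0" by (rule lyap_eqI[OF assms(1)]) (simp add: matrix_mul.zero_left matrix_mul.zero_right)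
    then show ?thesis by (simp add: gW_def matrix_mul.zero_left matrix_mul.zero_right trace_def)
  qed
  ultimately have "len u v (\<lambda>_. A) = integral {u..v} (\<lambda>t. 0)"
    unfolding len_def by (intro integral_cong) simp
  then show ?thesis by simp
qed

lemma geodesic_length_minimizing:
  fixes \<gamma> :: "real \<Rightarrow> real^'n^'n"
  assumes geo: "geodesic_on {a..b} \<gamma>" and ab: "a < b"
  shows "length_minimizing a b \<gamma>"
  unfolding length_minimizing_def
proof (intro allI impI, elim conjE)
  fix u v and c :: "real \<Rightarrow> real^'n^'n"
  assume c: "pw_C1_curve u v c" and ends: "c u = \<gamma> a" "c v = \<gamma> b"
  show "len a b \<gamma> \<le> len u v c"
  proof (cases "u < v")
    case True
    then show ?thesis using geodesic_len_le[OF geo ab c _ ends] by blast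
  next
    \<comment> \<open>\<open>pw_C1_curve\<close> admits one-point intervals. The endpoints then
      coincide, and a constant curve on \<open>{0..1}\<close> replaces the competitor, with the same
      length 0.\<close>
    case False
    then have "u = v" using c by (simp add: pw_C1_curve_def)
    then have eq: "\<gamma> b = \<gamma> a" and len: "len u v c = 0" using ends by (simp_all add: len_def)
    have A: "\<gamma> a \<in> SPD" using geo ab by (auto simp: geodesic_on_def)
    have "len a b \<gamma> \<le> len 0 1 (\<lambda>_. \<gamma> a)"
      by (rule geodesic_len_le[OF geo ab pw_C1_curve_const[OF A]]) (simp_all add: eq)
    then show ?thesis using len_const[OF A, of 0 1] len by linarith
  qed
qed

lemma geodesic_on_subset:
  assumes "geodesic_on I \<gamma>" "J \<subseteq> I" "is_interval J"
  shows "geodesic_on J \<gamma>"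
  using assms unfolding geodesic_on_def by (blast intro: has_vector_derivative_within_subset)

theorem theorem5p3:
  shows "(\<forall>A\<in>(SPD :: (real^'n^'n) set). \<forall>B\<in>SPD.
            (\<exists>\<gamma>. geodesic_joining 0 1 \<gamma> A B) \<and>
            (\<forall>a b \<gamma> c d \<sigma>. geodesic_joining a b \<gamma> A B \<and> geodesic_joining c d \<sigma> A B \<longrightarrow>
               (\<forall>t\<in>{c..d}. \<sigma> t = \<gamma> (a + (b - a) * ((t - c) / (d - c))))))
       \<and> (\<forall>I a (\<gamma> :: real \<Rightarrow> real^'n^'n).
            geodesic_on I \<gamma> \<and> a \<in> I \<and> (\<forall>t\<in>I. a \<le> t) \<longrightarrow> cut_points I a \<gamma> = {})"
proof (intro conjI ballI allI impI)
  fix A B :: "real^'n^'n"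
  assume "A \<in> SPD" "B \<in> SPD"
  then show "\<exists>\<gamma>. geodesic_joining 0 1 \<gamma> A B" by (rule geodesic_joining_exists)
next
  fix A B :: "real^'n^'n" and a b \<gamma> c d \<sigma> t
  assume "A \<in> SPD" "B \<in> SPD" "geodesic_joining a b \<gamma> A B \<and> geodesic_joining c d \<sigma> A B" "t \<in> {c..d}"
  then show "\<sigma> t = \<gamma> (a + (b - a) * ((t - c) / (d - c)))" using geodesic_joining_unique by blast
next
  fix I a and \<gamma> :: "real \<Rightarrow> real^'n^'n"
  assume I: "geodesic_on I \<gamma> \<and> a \<in> I \<and> (\<forall>t\<in>I. a \<le> t)"
  have "length_minimizing a t \<gamma>" if "t \<in> I" "a < t" for t
  proof -
    have "is_interval I" using I by (simp add: geodesic_on_def)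
    then have "{a..t} \<subseteq> I"
      using mem_is_interval_1_I[of I a t] I that(1) by (metis atLeastAtMost_iff subsetI)
    then show ?thesis
      using geodesic_length_minimizing geodesic_on_subset[of I \<gamma> "{a..t}"] I that(2) is_interval_cc by blast
  qed
  \<comment> \<open>A cut point at parameter \<open>s\<close> would have a later \<open>t\<close> in
    \<open>I\<close>; as \<open>a \<le> s < t\<close>, the geodesic is minimizing up to
    \<open>t\<close>, a contradiction.\<close>
  then show "cut_points I a \<gamma> = {}" using I unfolding cut_points_def by force
qed

end
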